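(* Let $p>1$ and let $f,g,\rho,d$ satisfy the standing assumptions. Assume that $d(u)\sim k_1u^\delta$ and $\rho(u)\sim k_2u^r$ as $u\to0^+$, for some positive constants $k_1,k_2,r$ and $\delta\in\mathbb R$ satisfying $$r\ge\frac{1-\delta}{p-1}.$$ Let $c^*$ be the threshold speed and let $u$ be the traveling wave solution having speed $c^*$, defined in $(\alpha,\beta)$. Then: - if $r<1$, we have $\beta<+\infty$; - if $r=\frac{1-\delta}{p-1}\ge1$, we have $\beta=+\infty$; - if $r>\frac{1-\delta}{p-1}$ and $c^*g(0)>f(0)$, we have $\beta<+\infty$ if and only if $\frac{1-\delta}{p-1}<1$. Moreover, when $\beta<+\infty$: - if $\delta<1$, then $u'(\beta^-)=0$; - if $\delta=1$, then $u'(\beta^-)=0$ if and only if $c^*g(0)-f(0)=0$; - if $\delta>1$ and $c^*g(0)>f(0)$, then $u'(\beta^-)=-\infty$.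
   Context: Standing assumptions: $p>1$; $f,g,\rho\in C[0,1]$; $d\in C^1(0,1)$; $\rho(u)>0$ in $(0,1)$ and $\rho(0)=\rho(1)=0$; $g(0)>0$ and $\int_0^u g(s)\,ds>0$ for every $u\in(0,1]$; $d(u)>0$ in $(0,1)$ and $\rho\, d^{\frac1{p-1}}\in L^1(0,1)$. A traveling wave solution (t.w.s.) with speed $c\in\mathbb R$ is a function $u\in C^1(\alpha,\beta)$, with $-\infty\le\alpha<\beta\le+\infty$, such that $0<u(t)<1$ for all $t\in(\alpha,\beta)$, $d(u)|u'|^{p-2}u'\in C^1(\alpha,\beta)$, $$(d(u)|u'|^{p-2}u')'+(cg(u)-f(u))u'+\rho(u)=0\quad\text{in }(\alpha,\beta),$$ $u(\alpha^+)=1$, $u(\beta^-)=0$, and $\lim_{t\to\alpha^+}d(u)|u'|^{p-2}u'=\lim_{t\to\beta^-}d(u)|u'|^{p-2}u'=0$. Whenever $\lim_{u\to0^+}\rho(u)(d(u)/u)^{\frac1{p-1}}$ exists and is finite (as here), there is a threshold $c^*\in\mathbb R$ such that a t.w.s. with speed $c$ exists if and only if $c\ge c^*$, and for each such $c$ it is unique up to translation. $a\sim b$ means that $a/b\to1$; $u'(\beta^-)=\lim_{t\to\beta^-}u'(t)$. *)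

theory Defs
  imports "HOL-Analysis.Analysis" "HOL-Library.Landau_Symbols"
begin

text \<open>
  The flux \<open>d(u) |u'|\<^sup>p\<^sup>-\<^sup>2 u'\<close>. Where \<open>u' = 0\<close> it vanishes for every \<open>p > 1\<close>, which
  agrees with the continuous extension of \<open>|s|\<^sup>p\<^sup>-\<^sup>2 s\<close> to \<open>s = 0\<close>.
\<close>

definition flux :: "real \<Rightarrow> (real \<Rightarrow> real) \<Rightarrow> (real \<Rightarrow> real) \<Rightarrow> real \<Rightarrow> real" where
  "flux p d u t = d (u t) * \<bar>deriv u t\<bar> powr (p - 2) * deriv u t"

text \<open>
  The domain \<open>einterval \<alpha> \<beta>\<close> may be unbounded on either side. One-sided limits at its
  end points are taken along \<open>at_right \<alpha>\<close> and \<open>at_left \<beta>\<close> in the extended reals, so that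
  they are limits at \<open>-\<infinity>\<close> or \<open>\<infinity>\<close> when the end point is infinite
  (see \<open>ereal_tendsto_simps\<close>).
\<close>

definition travelling_wave ::
  "real \<Rightarrow> (real \<Rightarrow> real) \<Rightarrow> (real \<Rightarrow> real) \<Rightarrow> (real \<Rightarrow> real) \<Rightarrow> (real \<Rightarrow> real) \<Rightarrow>
   real \<Rightarrow> ereal \<Rightarrow> ereal \<Rightarrow> (real \<Rightarrow> real) \<Rightarrow> bool" where
  "travelling_wave p d f g \<rho> c \<alpha> \<beta> u \<longleftrightarrow>
     \<alpha> < \<beta> \<and>
     u C1_differentiable_on einterval \<alpha> \<beta> \<and>
     (\<forall>t\<in>einterval \<alpha> \<beta>. 0 < u t \<and> u t < 1) \<and>
     flux p d u C1_differentiable_on einterval \<alpha> \<beta> \<and>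
     (\<forall>t\<in>einterval \<alpha> \<beta>.
        deriv (flux p d u) t + (c * g (u t) - f (u t)) * deriv u t + \<rho> (u t) = 0) \<and>
     ((u \<circ> real_of_ereal) \<longlongrightarrow> 1) (at_right \<alpha>) \<and>
     ((u \<circ> real_of_ereal) \<longlongrightarrow> 0) (at_left \<beta>) \<and>
     ((flux p d u \<circ> real_of_ereal) \<longlongrightarrow> 0) (at_right \<alpha>) \<and>
     ((flux p d u \<circ> real_of_ereal) \<longlongrightarrow> 0) (at_left \<beta>)"

text \<open>There is at most one threshold speed for given \<open>p\<close>, \<open>d\<close>, \<open>f\<close>, \<open>g\<close>, \<open>\<rho>\<close>.\<close>

definition threshold_speed ::
  "real \<Rightarrow> (real \<Rightarrow> real) \<Rightarrow> (real \<Rightarrow> real) \<Rightarrow> (real \<Rightarrow> real) \<Rightarrow> (real \<Rightarrow> real) \<Rightarrow> real \<Rightarrow> bool" where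
  "threshold_speed p d f g \<rho> c\<^sub>0 \<longleftrightarrow>
     (\<forall>c. (\<exists>\<alpha> \<beta> u. travelling_wave p d f g \<rho> c \<alpha> \<beta> u) \<longleftrightarrow> c\<^sub>0 \<le> c)"

end

theory Submission
  imports Defs "HOL-Real_Asymp.Real_Asymp"
begin

text \<open>
  A wave is strictly decreasing, so \<open>y(u) = -d(u) |u'|\<^sup>p\<^sup>-\<^sup>2 u'\<close> is a function of \<open>u\<close>. With
  \<open>q = 1 / (p - 1)\<close> it is a positive solution of \<open>y' = c g - f - \<rho> d\<^sup>q y\<^sup>-\<^sup>q\<close> on \<open>(0, 1)\<close> vanishing
  at both ends; conversely, every such solution is the profile of a wave. As \<open>u' = -(y / d)\<^sup>q\<close>,
  the end point \<open>\<beta>\<close> is finite iff \<open>(d / y)\<^sup>q\<close> is integrable at \<open>0\<close>, and everything depends on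
  the size of \<open>y\<close> near \<open>0\<close>. Always \<open>\<eta> v\<^sup>s\<^sup>/\<^sup>q \<le> y(v) \<le> M v\<close> with \<open>s = r + \<delta> q\<close>, the lower bound
  because a smaller \<open>y\<close> would be driven below \<open>0\<close>. If \<open>s > q\<close> and \<open>c g(0) > f(0)\<close>,
  the threshold speed improves the lower bound to \<open>\<epsilon> v\<close>.
\<close>

text \<open>If \<open>y\<close> has order v^e at 0, then (d / y)^q has order v^(-(e - \<delta>) q),
  so \<open>\<beta>\<close> is finite iff (e - \<delta>) q < 1. The candidate orders e = s / q and e
  = 1 turn this into r < 1 and (1 - \<delta>) q < 1, the two criteria of the theorem; they coincide
  when s = q. The obstacle is the linear order of the critical profile when s > q and c g(0) > f(0).
  The equation alone does not select it, so minimality of the speed has to enter: if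
  \<open>y\<close> were too small, a wave of slightly smaller speed could be constructed. As
  \<open>g\<close> may change sign, profiles need not be monotone in the speed, and an ordering of
  profiles is replaced by the estimate |z - y| \<le> K (1 - v). It holds because the reaction term,
  although singular at y = 0, increases with \<open>y\<close>: differences of solutions are not
  amplified when the equation is integrated from 1 towards 0. For this reason the approximating
  problems are solved from right to left.\<close>

section \<open>Solutions of the first-order equation\<close>

text \<open>Barrier argument behind most comparisons below, with \<open>f\<close> the signed
  distance to a barrier: the equation controls the slope only on the wrong side of the barrier. Up
  to the first point where \<open>f\<close> is nonnegative again \<open>f\<close> does not increase,
  so that point cannot exist.\<close>

lemma negative_persists:
  fixes f :: "real \<Rightarrow> real"
  assumes "a \<le> b" and cont: "continuous_on {a..b} f" and "f a < 0"
    and der: "\<And>x. a < x \<Longrightarrow> x < b \<Longrightarrow> f x < 0 \<Longrightarrow> \<exists>D\<le>0. (f has_real_derivative D) (at x)"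
  shows "f b \<le> f a"
proof -
  have mono: "f s \<le> f a" if "a < s" "s \<le> b" "\<And>x. a < x \<Longrightarrow> x < s \<Longrightarrow> f x < 0" for s
  proof (rule DERIV_nonpos_imp_decreasing_open[of a s f])
    show "a \<le> s" using that by simp
    show "\<exists>D. (f has_real_derivative D) (at x) \<and> D \<le> 0" if "a < x" "x < s" for x
      using der[of x] that \<open>s \<le> b\<close> \<open>\<And>x. a < x \<Longrightarrow> x < s \<Longrightarrow> f x < 0\<close> by fastforce
    show "continuous_on {a..s} f"
      using cont by (rule continuous_on_subset) (use that in auto)
  qed
  define S where "S = {x\<in>{a..b}. 0 \<le> f x}"
  have "S = {}"
  proof (rule ccontr)
    assume "S \<noteq> {}"
    have "closed S"
      unfolding S_def using continuous_closed_preimage[OF cont, of "{0..}"]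
      by (simp add: vimage_def Int_def)
    moreover have "bdd_below S" by (auto simp: S_def)
    ultimately have "Inf S \<in> S" using \<open>S \<noteq> {}\<close> by (intro closed_contains_Inf)
    moreover have "f x < 0" if "a < x" "x < Inf S" for x
      using that cInf_lower[OF _ \<open>bdd_below S\<close>, of x] \<open>Inf S \<in> S\<close> by (force simp: S_def)
    moreover have "a < Inf S"
      using \<open>Inf S \<in> S\<close> \<open>f a < 0\<close> unfolding S_def by (metis (mono_tags, lifting) atLeastAtMost_iff le_less mem_Collect_eq not_less)
    ultimately have "f (Inf S) \<le> f a" using mono[of "Inf S"] by (auto simp: S_def)
    with \<open>Inf S \<in> S\<close> \<open>f a < 0\<close> show False by (auto simp: S_def)
  qed
  show ?thesis
  proof (cases "a = b")
    case False
    with \<open>a \<le> b\<close> \<open>S = {}\<close> show ?thesis 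
      by (intro mono) (auto simp: S_def not_le[symmetric])
  qed simp
qed

section \<open>Terminal value problems with Lipschitz right-hand side\<close>

lemma powr_minus_lipschitz:
  fixes x y :: real
  assumes "q > 0" "e > 0" "e \<le> x" "e \<le> y"
  shows "\<bar>x powr - q - y powr - q\<bar> \<le> q * e powr (- q - 1) * \<bar>x - y\<bar>"
proof -
  have "norm (x powr - q - y powr - q) \<le> q * e powr (- q - 1) * norm (x - y)"
  proof (rule field_differentiable_bound[of "{e..}" _ "\<lambda>z. - q * z powr (- q - 1)"])
    fix z assume z: "z \<in> {e..}"
    then show "((\<lambda>z. z powr - q) has_field_derivative - q * z powr (- q - 1)) (at z within {e..})"
      using assms by (auto intro!: derivative_eq_intros)
    have "z powr (- q - 1) \<le> e powr (- q - 1)"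
      using z assms by (intro powr_mono2') auto
    with assms show "norm (- q * z powr (- q - 1)) \<le> q * e powr (- q - 1)"
      by (simp add: abs_mult)
  qed (use assms in auto)
  then show ?thesis by simp
qed

text \<open>The weight \<open>exp (\<lambda> (b - x))\<close> makes the integral operator a contraction on the whole
  interval (Bielecki's trick).\<close>

lemma terminal_value_problem:
  fixes F :: "real \<Rightarrow> real \<Rightarrow> real"
  assumes "a \<le> b" "L \<ge> 0"
    and lip: "\<And>v x y. v \<in> {a..b} \<Longrightarrow> \<bar>F v x - F v y\<bar> \<le> L * \<bar>x - y\<bar>"
    and cont: "\<And>y. continuous_on {a..b} y \<Longrightarrow> continuous_on {a..b} (\<lambda>v. F v (y v))"
  obtains y where "continuous_on {a..b} y" "y b = yb"
    "\<And>v. v \<in> {a<..<b} \<Longrightarrow> (y has_real_derivative F v (y v)) (at v)"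
proof -
  define l where "l = L + 1"
  have "l > 0" using \<open>L \<ge> 0\<close> by (simp add: l_def)
  define w where "w x = exp (l * (b - x))" for x
  have w_pos: "w x > 0" for x by (simp add: w_def)
  have w_cont [continuous_intros]: "continuous_on S w" for S
    unfolding w_def by (intro continuous_intros)
  \<comment> \<open>The unknown is z = y / w, so the sup distance of \<open>z1\<close> and
    \<open>z2\<close> is the weighted distance of the corresponding solutions.\<close>
  define J where "J z x = (yb - integral {x..b} (\<lambda>s. F s (w s * apply_bcontfun z s))) / w x" for z x
  have F_cont: "continuous_on {a..b} (\<lambda>s. F s (w s * apply_bcontfun z s))" for z
    by (intro cont continuous_intros) auto
  have J_cont: "continuous_on {a..b} (J z)" for z
    unfolding J_def using w_pos
    by (intro continuous_intros indefinite_integral_continuous_1' integrable_continuous_real F_cont)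
       (auto simp: less_imp_neq[symmetric] intro: less_imp_neq)
  \<comment> \<open>\<open>clamp\<close> extends \<open>J z\<close> from {a..b} to the whole line,
    which places the iteration in the complete type of bounded continuous functions.\<close>
  have "\<exists>g. \<forall>x. apply_bcontfun g x = J z (clamp a b x)" for z
    using continuous_on_cbox_bcontfunE[of a b "J z"] J_cont by (metis cbox_interval)
  then obtain T where T: "\<And>z x. apply_bcontfun (T z) x = J z (clamp a b x)" by metis
  \<comment> \<open>Source of the contraction: this integral is at most w x / l, and
    \<open>J\<close> divides by w x, which leaves the factor L / l < 1 whatever the length of the
    interval.\<close>
  have w_int: "integral {x..b} w = (w x - 1) / l" if "x \<le> b" for x
  proof -
    have "(w has_integral (- w b / l - - w x / l)) {x..b}"
      by (rule fundamental_theorem_of_calculus[OF that])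
        (use \<open>l > 0\<close> in \<open>auto simp: w_def has_real_derivative_iff_has_vector_derivative[symmetric]
          intro!: derivative_eq_intros\<close>)
    then show ?thesis by (simp add: integral_unique w_def diff_divide_distrib)
  qed
  have J_lip: "\<bar>J z1 x - J z2 x\<bar> \<le> L / l * dist z1 z2" if x: "x \<in> {a..b}" for z1 z2 x
  proof -
    let ?F = "\<lambda>z s. F s (w s * apply_bcontfun z s)"
    have sub: "continuous_on {x..b} (?F z)" for z
      using F_cont by (rule continuous_on_subset) (use x in auto)
    have "\<bar>integral {x..b} (?F z1) - integral {x..b} (?F z2)\<bar>
        = \<bar>integral {x..b} (\<lambda>s. ?F z1 s - ?F z2 s)\<bar>"
      by (simp add: integral_diff sub integrable_continuous_real)
    also have "\<dots> \<le> integral {x..b} (\<lambda>s. L * dist z1 z2 * w s)"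
    unfolding real_norm_def[symmetric]
    proof (rule Henstock_Kurzweil_Integration.integral_norm_bound_integral)
      show "(\<lambda>s. ?F z1 s - ?F z2 s) integrable_on {x..b}" "(\<lambda>s. L * dist z1 z2 * w s) integrable_on {x..b}"
        by (auto intro!: integrable_continuous_real continuous_intros sub)
      fix s assume "s \<in> {x..b}"
      then have "\<bar>?F z1 s - ?F z2 s\<bar> \<le> L * \<bar>w s * apply_bcontfun z1 s - w s * apply_bcontfun z2 s\<bar>"
        using x by (intro lip) auto
      also have "\<dots> = L * (w s * dist (apply_bcontfun z1 s) (apply_bcontfun z2 s))"
        using w_pos[of s] by (simp add: dist_real_def abs_mult flip: right_diff_distrib)
      also have "\<dots> \<le> L * (w s * dist z1 z2)"
        using w_pos[of s] \<open>L \<ge> 0\<close> by (intro mult_left_mono dist_bounded) auto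
      finally show "norm (?F z1 s - ?F z2 s) \<le> L * dist z1 z2 * w s" by (simp add: mult_ac)
    qed
    also have "\<dots> = L * dist z1 z2 * ((w x - 1) / l)"
      using x by (simp add: w_int)
    also have "\<dots> \<le> L * dist z1 z2 * (w x / l)"
      using \<open>L \<ge> 0\<close> \<open>l > 0\<close> by (intro mult_left_mono divide_right_mono) auto
    finally have *: "\<bar>integral {x..b} (?F z1) - integral {x..b} (?F z2)\<bar> \<le> L / l * dist z1 z2 * w x"
      by (simp add: mult_ac)
    have "\<bar>J z1 x - J z2 x\<bar> = \<bar>integral {x..b} (?F z1) - integral {x..b} (?F z2)\<bar> / w x"
      using w_pos[of x] by (simp add: J_def abs_minus_commute flip: diff_divide_distrib)
    also have "\<dots> \<le> L / l * dist z1 z2"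
      using * w_pos[of x] by (simp add: field_simps)
    finally show ?thesis .
  qed
  have "\<exists>!z. T z = z"
  proof (rule banach_fix_type)
    show "0 \<le> L / l" "L / l < 1" using \<open>L \<ge> 0\<close> by (auto simp: l_def)
    show "\<forall>z1 z2. dist (T z1) (T z2) \<le> L / l * dist z1 z2"
    proof (intro allI dist_bound)
      fix z1 z2 x
      have "clamp a b x \<in> {a..b}" using \<open>a \<le> b\<close> clamp_in_interval[of a b x] by auto
      from J_lip[OF this, of z1 z2]
      show "dist (apply_bcontfun (T z1) x) (apply_bcontfun (T z2) x) \<le> L / l * dist z1 z2"
        by (simp add: T dist_real_def)
    qed
  qed
  then obtain z where z: "T z = z" by auto
  define y where "y x = w x * apply_bcontfun z x" for x
  have y_eq: "y x = yb - integral {x..b} (\<lambda>s. F s (y s))" if "x \<in> {a..b}" for x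
    using that T[of z x] w_pos[of x] unfolding z by (auto simp: y_def J_def)
  have Fy_cont: "continuous_on {a..b} (\<lambda>s. F s (y s))"
    unfolding y_def by (rule F_cont)
  show ?thesis
  proof
    show "continuous_on {a..b} y"
      unfolding y_def by (intro continuous_intros) auto
    show "y b = yb" using y_eq[of b] \<open>a \<le> b\<close> by simp
    fix v assume v: "v \<in> {a<..<b}"
    have "((\<lambda>x. yb - integral {x..b} (\<lambda>s. F s (y s))) has_real_derivative F v (y v)) (at v within {a..b})"
      using v Fy_cont
      by (auto intro!: derivative_eq_intros integral_has_real_derivative' integrable_continuous_real)
    then have "(y has_real_derivative F v (y v)) (at v within {a..b})"
      by (rule has_field_derivative_transform_within[of _ _ _ _ 1]) (use v y_eq in auto)
    moreover have "at v within {a..b} = at v"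
      using v by (intro at_within_interior) (auto simp: interior_atLeastAtMost_real)
    ultimately show "(y has_real_derivative F v (y v)) (at v)" by simp
  qed
qed

section \<open>Comparison of positive solutions and lower bounds for them\<close>

text \<open>Since -h y^(-q) increases with \<open>y\<close>, the difference of two solutions has
  slope at least -K wherever it is positive. Leftwards it therefore grows at most linearly, with no
  Lipschitz constant in the estimate, so the bound survives as the solutions approach the
  singularity y = 0.\<close>

lemma perturbation_bound:
  fixes y1 y2 :: "real \<Rightarrow> real"
  assumes "a \<le> b" "0 \<le> K" "0 < q"
    and cont: "continuous_on {a..b} y1" "continuous_on {a..b} y2"
    and h: "\<And>v. v \<in> {a<..<b} \<Longrightarrow> 0 \<le> h v"
    and pos: "\<And>v. v \<in> {a<..<b} \<Longrightarrow> 0 < y1 v" "\<And>v. v \<in> {a<..<b} \<Longrightarrow> 0 < y2 v"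
    and der: "\<And>v. v \<in> {a<..<b} \<Longrightarrow> (y1 has_real_derivative a1 v - h v * y1 v powr - q) (at v)"
      "\<And>v. v \<in> {a<..<b} \<Longrightarrow> (y2 has_real_derivative a2 v - h v * y2 v powr - q) (at v)"
    and K: "\<And>v. v \<in> {a<..<b} \<Longrightarrow> \<bar>a1 v - a2 v\<bar> \<le> K"
  shows "\<bar>y1 a - y2 a\<bar> \<le> \<bar>y1 b - y2 b\<bar> + K * (b - a)"
proof -
  have one_sided: "x1 a - x2 a \<le> \<bar>x1 b - x2 b\<bar> + K * (b - a)"
    if cont: "continuous_on {a..b} x1" "continuous_on {a..b} x2"
    and pos: "\<And>v. v \<in> {a<..<b} \<Longrightarrow> 0 < x1 v" "\<And>v. v \<in> {a<..<b} \<Longrightarrow> 0 < x2 v"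
    and der: "\<And>v. v \<in> {a<..<b} \<Longrightarrow> (x1 has_real_derivative b1 v - h v * x1 v powr - q) (at v)"
      "\<And>v. v \<in> {a<..<b} \<Longrightarrow> (x2 has_real_derivative b2 v - h v * x2 v powr - q) (at v)"
    and K: "\<And>v. v \<in> {a<..<b} \<Longrightarrow> \<bar>b1 v - b2 v\<bar> \<le> K"
    for x1 x2 b1 b2
  proof (rule ccontr)
    assume contr: "\<not> ?thesis"
    \<comment> \<open>Where \<open>f\<close> is negative, \<open>x1 - x2\<close> exceeds a
      nonnegative barrier, so the two reaction terms are ordered in the favourable
      direction.\<close>
    define f where "f x = \<bar>x1 b - x2 b\<bar> + K * (b - x) - (x1 x - x2 x)" for x
    have "f b \<le> f a"
    proof (rule negative_persists[OF \<open>a \<le> b\<close>, of f])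
      show "continuous_on {a..b} f" unfolding f_def by (intro continuous_intros cont)
      show "f a < 0" using contr by (simp add: f_def)
      fix x assume x: "a < x" "x < b" "f x < 0"
      have "0 \<le> K * (b - x)" using x \<open>0 \<le> K\<close> by simp
      then have "x2 x \<le> x1 x" using x(3) by (simp add: f_def)
      then have "x1 x powr - q \<le> x2 x powr - q"
        using pos[of x] x \<open>0 < q\<close> by (intro powr_mono2') auto
      then have "h x * x1 x powr - q \<le> h x * x2 x powr - q"
        using h[of x] x by (intro mult_left_mono) auto
      moreover have "- K - ((b1 x - h x * x1 x powr - q) - (b2 x - h x * x2 x powr - q)) \<le> 0"
        using calculation K[of x] x by (simp add: abs_le_iff)
      moreover have "(f has_real_derivative
          - K - ((b1 x - h x * x1 x powr - q) - (b2 x - h x * x2 x powr - q))) (at x)"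
        unfolding f_def using der[of x] x by (auto intro!: derivative_eq_intros)
      ultimately show "\<exists>D\<le>0. (f has_real_derivative D) (at x)" by blast
    qed
    with contr show False by (simp add: f_def)
  qed
  show ?thesis
    using one_sided[OF cont pos der K] one_sided[OF cont(2,1) pos(2,1) der(2,1)] K
    by (auto simp: abs_le_iff abs_minus_commute)
qed

text \<open>Below the level \<open>\<kappa>\<close> the reaction term forces a slope less than \<open>-\<kappa> / (v2 - v1)\<close>, so a
  solution starting there would be negative at \<open>v2\<close>.\<close>

lemma strong_reaction_lower_bound:
  fixes y :: "real \<Rightarrow> real"
  assumes "v1 < v2" "0 < \<kappa>" "0 < q"
    and cont: "continuous_on {v1..v2} y"
    and pos: "\<And>v. v \<in> {v1..v2} \<Longrightarrow> 0 < y v"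
    and der: "\<And>v. v \<in> {v1<..<v2} \<Longrightarrow> (y has_real_derivative a v - h v * y v powr - q) (at v)"
    and A: "\<And>v. v \<in> {v1<..<v2} \<Longrightarrow> a v \<le> A" and m: "\<And>v. v \<in> {v1<..<v2} \<Longrightarrow> m \<le> h v"
    and "0 \<le> m" and large: "A + \<kappa> / (v2 - v1) \<le> m * \<kappa> powr - q"
  shows "\<kappa> \<le> y v1"
proof (rule ccontr)
  assume contr: "\<not> ?thesis"
  \<comment> \<open>Distance of \<open>y\<close> to the chord from (v1, \<kappa>) to (v2, 0):
    staying below the chord would force a negative value at \<open>v2\<close>.\<close>
  define f where "f x = y x - \<kappa> + \<kappa> / (v2 - v1) * (x - v1)" for x
  have "f v2 \<le> f v1"
  proof (rule negative_persists[of v1 v2 f])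
    show "v1 \<le> v2" using assms by simp
    show "continuous_on {v1..v2} f" unfolding f_def by (intro continuous_intros cont)
    show "f v1 < 0" using contr by (simp add: f_def)
    fix x assume x: "v1 < x" "x < v2" "f x < 0"
    have "0 \<le> \<kappa> / (v2 - v1) * (x - v1)" using assms x by simp
    then have "y x \<le> \<kappa>" using x(3) unfolding f_def by linarith
    then have "\<kappa> powr - q \<le> y x powr - q"
      using pos[of x] x assms by (intro powr_mono2') auto
    then have "m * \<kappa> powr - q \<le> h x * y x powr - q"
      using m[of x] x \<open>0 \<le> m\<close> by (intro mult_mono) auto
    then have "a x - h x * y x powr - q + \<kappa> / (v2 - v1) \<le> 0" using A[of x] large x by auto
    moreover have "(f has_real_derivative a x - h x * y x powr - q + \<kappa> / (v2 - v1)) (at x)"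
      unfolding f_def using der[of x] x by (auto intro!: derivative_eq_intros)
    ultimately show "\<exists>D\<le>0. (f has_real_derivative D) (at x)" by blast
  qed
  moreover have "f v2 = y v2" using assms(1) by (simp add: f_def)
  ultimately show False using contr pos[of v2] assms(1) by (simp add: f_def)
qed

section \<open>Positive solutions of the singular equation and their perturbation\<close>

lemma powr_minus_ge_small:
  fixes q m e B :: real
  assumes "0 < q" "0 < m" "0 < e"
  obtains x where "0 < x" "x \<le> e" "B \<le> m * x powr - q"
proof
  define x where "x = min e ((m / (\<bar>B\<bar> + 1)) powr (1 / q))"
  show "0 < x" "x \<le> e" using assms by (auto simp: x_def)
  have "(\<bar>B\<bar> + 1) / m = ((m / (\<bar>B\<bar> + 1)) powr (1 / q)) powr - q"
    using assms by (simp add: powr_powr powr_minus_divide)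
  also have "\<dots> \<le> x powr - q"
    using \<open>0 < x\<close> \<open>0 < q\<close> by (intro powr_mono2') (auto simp: x_def)
  finally show "B \<le> m * x powr - q"
    using assms by (simp add: field_simps)
qed

lemma positive_terminal_value_problem:
  fixes h :: "real \<Rightarrow> real"
  assumes "a < b" "0 < q" "0 < yb"
    and h_cont: "continuous_on {a..b} h" and h_pos: "\<And>v. v \<in> {a..b} \<Longrightarrow> 0 < h v"
    and A_cont: "continuous_on {a..b} A"
  obtains y where "continuous_on {a..b} y" "y b = yb" "\<And>v. v \<in> {a..b} \<Longrightarrow> 0 < y v"
    "\<And>v. v \<in> {a<..<b} \<Longrightarrow> (y has_real_derivative A v - h v * y v powr - q) (at v)"
proof -
  have ne: "{a..b} \<noteq> {}" using \<open>a < b\<close> by simp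
  obtain m where m: "0 < m" "\<And>v. v \<in> {a..b} \<Longrightarrow> m \<le> h v"
    using continuous_attains_inf[OF _ ne h_cont] h_pos by (metis compact_Icc)
  obtain H where H: "\<And>v. v \<in> {a..b} \<Longrightarrow> h v \<le> H"
    using continuous_attains_sup[OF _ ne h_cont] by (metis compact_Icc)
  obtain M where M: "\<And>v. v \<in> {a..b} \<Longrightarrow> A v \<le> M"
    using continuous_attains_sup[OF _ ne A_cont] by (metis compact_Icc)
  have "0 \<le> H" using H[of a] h_pos[of a] \<open>a < b\<close> by auto
  obtain e where e: "0 < e" "e \<le> yb" "M \<le> m * e powr - q"
    using powr_minus_ge_small[OF \<open>0 < q\<close> \<open>0 < m\<close> \<open>0 < yb\<close>] by metis
  define F where "F v x = A v - h v * max x e powr - q" for v x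
  obtain y where y: "continuous_on {a..b} y" "y b = yb"
    "\<And>v. v \<in> {a<..<b} \<Longrightarrow> (y has_real_derivative F v (y v)) (at v)"
  proof (rule terminal_value_problem[of a b "H * (q * e powr (- q - 1))" F yb])
    show "a \<le> b" "0 \<le> H * (q * e powr (- q - 1))" using assms \<open>0 \<le> H\<close> by auto
    fix v x z :: real assume v: "v \<in> {a..b}"
    have "\<bar>F v x - F v z\<bar> = h v * \<bar>max x e powr - q - max z e powr - q\<bar>"
      using h_pos[OF v] by (simp add: F_def abs_mult abs_minus_commute flip: right_diff_distrib)
    also have "\<dots> \<le> H * (q * e powr (- q - 1) * \<bar>max x e - max z e\<bar>)"
      using H[OF v] h_pos[OF v] \<open>0 \<le> H\<close> e assms by (intro mult_mono powr_minus_lipschitz) auto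
    also have "\<dots> \<le> H * (q * e powr (- q - 1) * \<bar>x - z\<bar>)"
      using \<open>0 \<le> H\<close> \<open>0 < q\<close> by (intro mult_left_mono) auto
    finally show "\<bar>F v x - F v z\<bar> \<le> H * (q * e powr (- q - 1)) * \<bar>x - z\<bar>" by (simp add: mult_ac)
  next
    fix y :: "real \<Rightarrow> real" assume "continuous_on {a..b} y"
    then show "continuous_on {a..b} (\<lambda>v. F v (y v))"
      unfolding F_def using e by (intro continuous_intros A_cont h_cont) auto
  qed blast
  have above: "e \<le> y v" if v: "v \<in> {a..b}" for v
  proof (rule ccontr)
    assume "\<not> e \<le> y v"
    have "y b - e \<le> y v - e"
    proof (rule negative_persists[of v b "\<lambda>x. y x - e"])
      show "continuous_on {v..b} (\<lambda>x. y x - e)"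
        by (intro continuous_intros continuous_on_subset[OF y(1)]) (use v in auto)
      fix x assume x: "v < x" "x < b" "y x - e < 0"
      have "m * e powr - q \<le> h x * max (y x) e powr - q"
        using m x v h_pos[of x] by (intro mult_mono) (auto simp: less_imp_le)
      moreover have "A x \<le> M" using M x v by simp
      ultimately have "F x (y x) \<le> 0" unfolding F_def using e(3) by linarith
      have "((\<lambda>x. y x - e) has_real_derivative F x (y x)) (at x)"
        using y(3)[of x] x v by (auto intro!: derivative_eq_intros)
      with \<open>F x (y x) \<le> 0\<close> show "\<exists>D\<le>0. ((\<lambda>x. y x - e) has_real_derivative D) (at x)" by blast
    qed (use v \<open>\<not> e \<le> y v\<close> in auto)
    with \<open>\<not> e \<le> y v\<close> e y(2) show False by auto
  qed
  show ?thesis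
  proof
    show "0 < y v" if "v \<in> {a..b}" for v using above[OF that] e by linarith
    show "(y has_real_derivative A v - h v * y v powr - q) (at v)" if "v \<in> {a<..<b}" for v
      using y(3)[OF that] above[of v] that by (simp add: F_def max_absorb1)
  qed (use y in auto)
qed

text \<open>The point is the order of quantifiers: \<open>\<kappa>\<close> serves all positive
  solutions on {v1..v3}. It keeps a sequence of approximate solutions away from the singularity
  uniformly. The margin between \<open>v2\<close> and \<open>v3\<close> is the room in which a
  smaller solution would be driven to 0.\<close>

lemma uniform_lower_bound:
  fixes h A :: "real \<Rightarrow> real"
  assumes "v1 \<le> v2" "v2 < v3" "0 < q"
    and h_cont: "continuous_on {v1..v3} h" and h_pos: "\<And>v. v \<in> {v1..v3} \<Longrightarrow> 0 < h v"
    and A_cont: "continuous_on {v1..v3} A"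
  obtains \<kappa> where "0 < \<kappa>"
    "\<And>y v. \<lbrakk>continuous_on {v1..v3} y; \<And>x. x \<in> {v1..v3} \<Longrightarrow> 0 < y x;
       \<And>x. x \<in> {v1<..<v3} \<Longrightarrow> (y has_real_derivative A x - h x * y x powr - q) (at x);
       v \<in> {v1..v2}\<rbrakk> \<Longrightarrow> \<kappa> \<le> y v"
proof -
  have ne: "{v1..v3} \<noteq> {}" using assms by simp
  obtain m where m: "0 < m" "\<And>v. v \<in> {v1..v3} \<Longrightarrow> m \<le> h v"
    using continuous_attains_inf[OF _ ne h_cont] h_pos by (metis compact_Icc)
  obtain M where M: "\<And>v. v \<in> {v1..v3} \<Longrightarrow> A v \<le> M"
    using continuous_attains_sup[OF _ ne A_cont] by (metis compact_Icc)
  \<comment> \<open>The bound by v3 - v2 makes the chord slope \<kappa> / (v3 - v) at most 1, which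
    explains the target M + 1.\<close>
  obtain \<kappa> where \<kappa>: "0 < \<kappa>" "\<kappa> \<le> v3 - v2" "M + 1 \<le> m * \<kappa> powr - q"
    using powr_minus_ge_small[OF \<open>0 < q\<close> \<open>0 < m\<close>, of "v3 - v2"] assms by (metis diff_gt_0_iff_gt)
  show ?thesis
  proof
    fix y v
    assume y: "continuous_on {v1..v3} y" "\<And>x. x \<in> {v1..v3} \<Longrightarrow> 0 < y x"
       "\<And>x. x \<in> {v1<..<v3} \<Longrightarrow> (y has_real_derivative A x - h x * y x powr - q) (at x)"
      and v: "v \<in> {v1..v2}"
    show "\<kappa> \<le> y v"
    proof (rule strong_reaction_lower_bound[of v v3 \<kappa> q y A h M m])
      show "v < v3" "0 < \<kappa>" "0 < q" "0 \<le> m" using v assms m \<kappa> by auto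
      show "continuous_on {v..v3} y" using y(1) by (rule continuous_on_subset) (use v in auto)
      have "\<kappa> / (v3 - v) \<le> 1" using \<kappa> v assms by auto
      then show "M + \<kappa> / (v3 - v) \<le> m * \<kappa> powr - q" using \<kappa> by linarith
    qed (use v y m M in auto)
  qed (fact \<kappa>)
qed

text \<open>The perturbed solution is the limit of solutions on \<open>[1/(n+3), 1 - 1/(n+3)]\<close> that start
  from the given one at the right end point, so nothing is required of \<open>h\<close> at \<open>0\<close> and \<open>1\<close>.\<close>

lemma perturbed_profile:
  fixes h A B ys :: "real \<Rightarrow> real"
  assumes "0 < q" "0 \<le> K"
    and h_cont: "continuous_on {0<..<1} h" and h_pos: "\<And>v. v \<in> {0<..<1} \<Longrightarrow> 0 < h v"
    and A_cont: "continuous_on {0<..<1} A"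
    and K: "\<And>v. v \<in> {0<..<1} \<Longrightarrow> \<bar>A v - B v\<bar> \<le> K"
    and ys_pos: "\<And>v. v \<in> {0<..<1} \<Longrightarrow> 0 < ys v"
    and ys_der: "\<And>v. v \<in> {0<..<1} \<Longrightarrow> (ys has_real_derivative B v - h v * ys v powr - q) (at v)"
  obtains y where "\<And>v. v \<in> {0<..<1} \<Longrightarrow> 0 < y v"
    "\<And>v. v \<in> {0<..<1} \<Longrightarrow> (y has_real_derivative A v - h v * y v powr - q) (at v)"
    "\<And>v. v \<in> {0<..<1} \<Longrightarrow> \<bar>y v - ys v\<bar> \<le> K * (1 - v)"
proof -
  \<comment> \<open>The shift by 3 gives a n < 1/2, so that every interval [a n, b n] is
    nondegenerate.\<close>
  define a :: "nat \<Rightarrow> real" where "a n = 1 / (real n + 3)" for n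
  define b where "b n = 1 - a n" for n
  have a_pos: "0 < a n" "a n < 1 / 2" for n by (auto simp: a_def field_simps)
  have a_mono: "a m \<le> a n" if "n \<le> m" for n m using that by (auto simp: a_def field_simps)
  have a_lim: "a \<longlonglongrightarrow> 0" using LIMSEQ_ignore_initial_segment[OF LIMSEQ_inverse_real_of_nat, of 2]
    by (simp add: a_def[abs_def] inverse_eq_divide add_ac)
  have sub: "{a n..b n} \<subseteq> {0<..<1}" for n using a_pos[of n] by (auto simp: b_def)
  have ab: "a n < b n" for n using a_pos[of n] by (auto simp: b_def)
  have "\<exists>Y. continuous_on {a n..b n} Y \<and> Y (b n) = ys (b n) \<and> (\<forall>v\<in>{a n..b n}. 0 < Y v) \<and>
    (\<forall>v\<in>{a n<..<b n}. (Y has_real_derivative A v - h v * Y v powr - q) (at v))" for n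
  proof -
    have bn: "b n \<in> {0<..<1}" using a_pos[of n] by (auto simp: b_def)
    obtain y where "continuous_on {a n..b n} y" "y (b n) = ys (b n)"
      "\<And>v. v \<in> {a n..b n} \<Longrightarrow> 0 < y v"
      "\<And>v. v \<in> {a n<..<b n} \<Longrightarrow> (y has_real_derivative A v - h v * y v powr - q) (at v)"
      using positive_terminal_value_problem[OF ab \<open>0 < q\<close> ys_pos[OF bn]
          continuous_on_subset[OF h_cont sub] h_pos continuous_on_subset[OF A_cont sub]] sub by blast
    then show ?thesis by blast
  qed
  then obtain Y where Y_cont: "\<And>n. continuous_on {a n..b n} (Y n)"
    and Y_end: "\<And>n. Y n (b n) = ys (b n)"
    and Y_pos: "\<And>n v. v \<in> {a n..b n} \<Longrightarrow> 0 < Y n v"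
    and Y_der: "\<And>n v. v \<in> {a n<..<b n} \<Longrightarrow> (Y n has_real_derivative A v - h v * Y n v powr - q) (at v)"
    by metis
  have ys_cont: "continuous_on {0<..<1} ys"
    using ys_der by (meson DERIV_isCont continuous_at_imp_continuous_on)
  have Y_ys: "\<bar>Y n v - ys v\<bar> \<le> K * (b n - v)" if v: "v \<in> {a n..b n}" for n v
  proof -
    have in01: "x \<in> {0<..<1}" if "x \<in> {v..b n}" for x
      using that v a_pos[of n] by (auto simp: b_def)
    have "\<bar>Y n v - ys v\<bar> \<le> \<bar>Y n (b n) - ys (b n)\<bar> + K * (b n - v)"
    proof (rule perturbation_bound[of v "b n" K q "Y n" ys h A B])
      show "continuous_on {v..b n} (Y n)" by (rule continuous_on_subset[OF Y_cont]) (use v in auto)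
      show "continuous_on {v..b n} ys" by (rule continuous_on_subset[OF ys_cont]) (use in01 in auto)
    qed (use assms v Y_pos Y_der in01 in \<open>auto simp: less_imp_le\<close>)
    then show ?thesis by (simp add: Y_end)
  qed
  \<comment> \<open>Both functions solve the same equation, so the perturbation constant is 0 and
    only the discrepancy at \<open>b n\<close> counts. There \<open>Y n\<close> equals
    \<open>ys\<close>, from which \<open>Y m\<close> has moved away by at most K (b m - b
    n).\<close>
  have Y_Y: "\<bar>Y n v - Y m v\<bar> \<le> K * a n" if v: "v \<in> {a n..b n}" and "n \<le> m" for n m v
  proof -
    have nm: "a m \<le> a n" "b n \<le> b m" using a_mono[OF \<open>n \<le> m\<close>] by (auto simp: b_def)
    have in01: "x \<in> {0<..<1}" if "x \<in> {v..b n}" for x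
      using that v a_pos[of n] by (auto simp: b_def)
    have "\<bar>Y n v - Y m v\<bar> \<le> \<bar>Y n (b n) - Y m (b n)\<bar> + 0 * (b n - v)"
    proof (rule perturbation_bound[of v "b n" 0 q "Y n" "Y m" h A A])
      show "continuous_on {v..b n} (Y n)" by (rule continuous_on_subset[OF Y_cont]) (use v in auto)
      show "continuous_on {v..b n} (Y m)" by (rule continuous_on_subset[OF Y_cont]) (use v nm in auto)
    qed (use assms v nm Y_pos Y_der in01 in \<open>auto simp: less_imp_le\<close>)
    also have "\<dots> \<le> K * (b m - b n)"
      using Y_ys[of "b n" m] nm ab[of n] by (simp add: Y_end abs_minus_commute)
    also have "\<dots> \<le> K * a n"
      using \<open>0 \<le> K\<close> a_pos[of m] by (intro mult_left_mono) (auto simp: b_def)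
    finally show ?thesis .
  qed
  have ev_in: "\<exists>N. \<forall>n\<ge>N. {x1..x2} \<subseteq> {a n<..<b n}" if "0 < x1" "x2 < 1" for x1 x2
  proof -
    have "\<forall>\<^sub>F n in sequentially. a n < min x1 (1 - x2)"
      by (rule order_tendstoD(2)[OF a_lim]) (use that in auto)
    then obtain N where "\<And>n. n \<ge> N \<Longrightarrow> a n < min x1 (1 - x2)"
      by (auto simp: eventually_sequentially)
    then show ?thesis by (intro exI[of _ N]) (force simp: b_def)
  qed
  have "convergent (\<lambda>n. Y n v)" if v: "v \<in> {0<..<1}" for v
  proof -
    obtain N where N: "\<And>n. n \<ge> N \<Longrightarrow> v \<in> {a n<..<b n}" using ev_in[of v v] v by auto
    have "Cauchy (\<lambda>n. Y n v)"
    proof (rule CauchyI')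
      fix e :: real assume "0 < e"
      have "(\<lambda>n. K * a n) \<longlonglongrightarrow> K * 0" by (intro tendsto_intros a_lim)
      then have "\<forall>\<^sub>F n in sequentially. K * a n < e" using \<open>0 < e\<close> by (intro order_tendstoD(2)) auto
      then obtain N' where N': "\<And>n. n \<ge> N' \<Longrightarrow> K * a n < e" by (auto simp: eventually_sequentially)
      show "\<exists>M. \<forall>m\<ge>M. \<forall>n>m. dist (Y m v) (Y n v) < e"
      proof (intro exI[of _ "max N N'"] allI impI)
        fix m n assume "max N N' \<le> m" "m < n"
        then show "dist (Y m v) (Y n v) < e"
          using Y_Y[of v m n] N[of m] N'[of m] by (simp add: dist_real_def)
      qed
    qed
    then show ?thesis by (simp add: Cauchy_convergent_iff)
  qed
  then obtain y where y: "\<And>v. v \<in> {0<..<1} \<Longrightarrow> (\<lambda>n. Y n v) \<longlonglongrightarrow> y v"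
    unfolding convergent_def by metis
  have Y_y: "\<bar>Y n v - y v\<bar> \<le> K * a n" if v: "v \<in> {a n..b n}" for n v
  proof (rule tendsto_upperbound)
    show "(\<lambda>m. \<bar>Y n v - Y m v\<bar>) \<longlonglongrightarrow> \<bar>Y n v - y v\<bar>"
      using v sub[of n] by (intro tendsto_intros y) auto
    show "\<forall>\<^sub>F m in sequentially. \<bar>Y n v - Y m v\<bar> \<le> K * a n"
      using eventually_ge_at_top[of n] by eventually_elim (use Y_Y v in auto)
  qed simp
  have loc: "0 < y v \<and> (y has_real_derivative A v - h v * y v powr - q) (at v)"
    if v: "v \<in> {0<..<1}" for v
  proof -
    \<comment> \<open>A window around \<open>v\<close>: the limit is differentiated on (v1, v2),
      while \<open>v3\<close> supplies the margin needed for the uniform lower bound.\<close>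
    define v1 v2 v3 where "v1 = v / 2" and "v2 = (v + 1) / 2" and "v3 = (v2 + 1) / 2"
    have vs: "0 < v1" "v1 < v" "v < v2" "v2 < v3" "v3 < 1"
      using v by (auto simp: v1_def v2_def v3_def)
    have sub13: "{v1..v3} \<subseteq> {0<..<1}" using vs by auto
    obtain \<kappa> where \<kappa>: "0 < \<kappa>"
      "\<And>y v. \<lbrakk>continuous_on {v1..v3} y; \<And>x. x \<in> {v1..v3} \<Longrightarrow> 0 < y x;
       \<And>x. x \<in> {v1<..<v3} \<Longrightarrow> (y has_real_derivative A x - h x * y x powr - q) (at x);
       v \<in> {v1..v2}\<rbrakk> \<Longrightarrow> \<kappa> \<le> y v"
    proof (rule uniform_lower_bound[of v1 v2 v3 q h A])
      show "continuous_on {v1..v3} h" "continuous_on {v1..v3} A"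
        by (rule continuous_on_subset[OF h_cont sub13] continuous_on_subset[OF A_cont sub13])+
    qed (use vs h_pos assms in auto)
    obtain N where N: "\<And>n. n \<ge> N \<Longrightarrow> {v1..v3} \<subseteq> {a n<..<b n}" using ev_in[of v1 v3] vs by auto
    have Y_ge: "\<kappa> \<le> Y n x" if "n \<ge> N" "x \<in> {v1..v2}" for n x
    proof (rule \<kappa>(2)[of "Y n"])
      have "{v1..v3} \<subseteq> {a n..b n}" using N[OF \<open>n \<ge> N\<close>] by force
      then show "continuous_on {v1..v3} (Y n)" by (rule continuous_on_subset[OF Y_cont])
      show "0 < Y n x" if "x \<in> {v1..v3}" for x
        using Y_pos \<open>{v1..v3} \<subseteq> {a n..b n}\<close> that by blast
      show "(Y n has_real_derivative A x - h x * Y n x powr - q) (at x)" if "x \<in> {v1<..<v3}" for x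
        using that subsetD[OF N[OF \<open>n \<ge> N\<close>], of x] by (intro Y_der) auto
    qed fact
    have y_ge: "\<kappa> \<le> y x" if "x \<in> {v1..v2}" for x
    proof (rule tendsto_lowerbound)
      show "(\<lambda>n. Y n x) \<longlonglongrightarrow> y x" using that vs by (intro y) auto
      show "\<forall>\<^sub>F n in sequentially. \<kappa> \<le> Y n x"
        using eventually_ge_at_top[of N] by eventually_elim (use Y_ge that in auto)
    qed simp
    have "compact (h ` {v1..v2})"
      by (intro compact_continuous_image continuous_on_subset[OF h_cont]) (use vs in auto)
    from bounded_imp_bdd_above[OF compact_imp_bounded[OF this]]
    obtain H where "\<forall>z\<in>h ` {v1..v2}. z \<le> H" unfolding bdd_above_def by blast
    then have H: "\<And>x. x \<in> {v1..v2} \<Longrightarrow> h x \<le> H" by blast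
    have "0 \<le> H" using H[of v] h_pos[of v] vs v by auto
    let ?S = "{v1<..<v2}"
    \<comment> \<open>The derivatives differ only in the reaction term, which is Lipschitz above
      \<open>\<kappa>\<close>. Uniform convergence of the solutions at rate K a(n) thus gives
      uniform convergence of the derivatives, and the limit solves the equation.\<close>
    have "\<exists>g. \<forall>x\<in>?S. (\<lambda>n. Y (n + N) x) \<longlonglongrightarrow> g x \<and>
      (g has_derivative (\<lambda>t. (A x - h x * y x powr - q) * t)) (at x within ?S)"
    proof (rule has_derivative_sequence)
      show "(Y (n + N) has_derivative (\<lambda>t. (A x - h x * Y (n + N) x powr - q) * t)) (at x within ?S)"
        if "x \<in> ?S" for n x
      proof -
        have "x \<in> {a (n + N)<..<b (n + N)}"
          using subsetD[OF N[of "n + N"], of x] that vs by auto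
        from has_derivative_at_withinI[OF Y_der[OF this, unfolded has_field_derivative_def]]
        show ?thesis .
      qed
      show "v \<in> ?S" using vs by simp
      show "(\<lambda>n. Y (n + N) v) \<longlonglongrightarrow> y v" by (rule LIMSEQ_ignore_initial_segment[OF y[OF v]])
      fix e :: real assume "0 < e"
      let ?L = "H * (q * \<kappa> powr (- q - 1) * K)"
      have "(\<lambda>n. ?L * a (n + N)) \<longlonglongrightarrow> ?L * 0"
        by (intro tendsto_intros LIMSEQ_ignore_initial_segment[OF a_lim])
      then have "\<forall>\<^sub>F n in sequentially. ?L * a (n + N) < e" using \<open>0 < e\<close> by (intro order_tendstoD(2)) auto
      then show "\<forall>\<^sub>F n in sequentially. \<forall>x\<in>?S. \<forall>t. norm ((A x - h x * Y (n + N) x powr - q) * t -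
          (A x - h x * y x powr - q) * t) \<le> e * norm t"
      proof (eventually_elim, intro ballI allI)
        fix n x and t :: real assume n: "?L * a (n + N) < e" and x: "x \<in> ?S"
        have x_in: "x \<in> {a (n + N)..b (n + N)}"
          using subsetD[OF N[of "n + N"], of x] x vs by auto
        have "\<bar>h x * Y (n + N) x powr - q - h x * y x powr - q\<bar>
            = h x * \<bar>Y (n + N) x powr - q - y x powr - q\<bar>"
          using h_pos[of x] x vs by (simp add: abs_mult flip: right_diff_distrib)
        also have "\<dots> \<le> H * (q * \<kappa> powr (- q - 1) * \<bar>Y (n + N) x - y x\<bar>)"
          using H[of x] h_pos[of x] x vs \<open>0 \<le> H\<close> \<kappa>(1) \<open>0 < q\<close> Y_ge[of "n + N" x] y_ge[of x]
          by (intro mult_mono powr_minus_lipschitz) auto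
        also have "\<dots> \<le> H * (q * \<kappa> powr (- q - 1) * (K * a (n + N)))"
          using Y_y[OF x_in] \<open>0 \<le> H\<close> \<open>0 < q\<close> by (intro mult_left_mono) auto
        also have "\<dots> \<le> e" using n by (simp add: mult_ac)
        finally have *: "\<bar>h x * Y (n + N) x powr - q - h x * y x powr - q\<bar> * \<bar>t\<bar> \<le> e * \<bar>t\<bar>"
          by (intro mult_right_mono) auto
        have "(A x - h x * Y (n + N) x powr - q) * t - (A x - h x * y x powr - q) * t
            = - ((h x * Y (n + N) x powr - q - h x * y x powr - q) * t)"
          by (simp add: algebra_simps)
        then show "norm ((A x - h x * Y (n + N) x powr - q) * t - (A x - h x * y x powr - q) * t)
            \<le> e * norm t"
          using * by (simp add: abs_mult)
      qed
    qed auto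
    then obtain g where g: "\<And>x. x \<in> ?S \<Longrightarrow> (\<lambda>n. Y (n + N) x) \<longlonglongrightarrow> g x"
      "\<And>x. x \<in> ?S \<Longrightarrow> (g has_derivative (\<lambda>t. (A x - h x * y x powr - q) * t)) (at x within ?S)"
      by blast
    have gy: "g x = y x" if "x \<in> ?S" for x
      using LIMSEQ_unique[OF g(1)[OF that] LIMSEQ_ignore_initial_segment[OF y]] that vs by auto
    have "v \<in> ?S" using vs by simp
    have "(g has_real_derivative A v - h v * y v powr - q) (at v)"
      using g(2)[OF \<open>v \<in> ?S\<close>] at_within_open[OF \<open>v \<in> ?S\<close>] by (simp add: has_field_derivative_def)
    then have "(y has_real_derivative A v - h v * y v powr - q) (at v)"
      by (rule has_field_derivative_transform_within_open[of _ _ _ ?S]) (use \<open>v \<in> ?S\<close> gy in auto)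
    with y_ge[of v] \<kappa>(1) vs show ?thesis by auto
  qed
  show ?thesis
  proof
    show "0 < y v" "(y has_real_derivative A v - h v * y v powr - q) (at v)"
      if "v \<in> {0<..<1}" for v using loc[OF that] by auto
    show "\<bar>y v - ys v\<bar> \<le> K * (1 - v)" if v: "v \<in> {0<..<1}" for v
    proof (rule tendsto_upperbound)
      obtain N where N: "\<And>n. n \<ge> N \<Longrightarrow> v \<in> {a n<..<b n}" using ev_in[of v v] v by auto
      show "(\<lambda>n. \<bar>Y n v - ys v\<bar>) \<longlonglongrightarrow> \<bar>y v - ys v\<bar>"
        using v by (intro tendsto_intros y) auto
      show "\<forall>\<^sub>F n in sequentially. \<bar>Y n v - ys v\<bar> \<le> K * (1 - v)"
        using eventually_ge_at_top[of N]
      proof eventually_elim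
        case (elim n)
        have "\<bar>Y n v - ys v\<bar> \<le> K * (b n - v)" using N[OF elim] by (intro Y_ys) auto
        also have "\<dots> \<le> K * (1 - v)"
          using \<open>0 \<le> K\<close> a_pos[of n] by (intro mult_left_mono) (auto simp: b_def)
        finally show ?case .
      qed
    qed simp
  qed
qed

section \<open>Waves and their profiles\<close>

lemma einterval_between:
  assumes "s \<in> einterval \<alpha> \<beta>" "t \<in> einterval \<alpha> \<beta>" "s \<le> x" "x \<le> t"
  shows "x \<in> einterval \<alpha> \<beta>"
proof -
  have "\<alpha> < ereal s" "ereal s \<le> ereal x" "ereal x \<le> ereal t" "ereal t < \<beta>"
    using assms by (auto simp: einterval_def)
  then show ?thesis
    unfolding einterval_def by (metis (mono_tags) less_le_trans le_less_trans mem_Collect_eq)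
qed

lemma flux_decreasing:
  assumes "deriv u t < 0"
  shows "flux p d u t = - (d (u t) * (- deriv u t) powr (p - 1))"
proof -
  have "(- deriv u t) powr (p - 2) * (- deriv u t) = (- deriv u t) powr (p - 1)"
    using assms powr_mult_base[of "- deriv u t" "p - 2"] by (simp add: mult.commute)
  then have "(- deriv u t) powr (p - 2) * deriv u t = - ((- deriv u t) powr (p - 1))" by simp
  then show ?thesis using assms by (simp add: flux_def mult.assoc)
qed

text \<open>Where the flux vanishes the equation gives it the derivative \<open>-\<rho>(u) < 0\<close>. Hence a point with
  \<open>u' \<ge> 0\<close> would make \<open>u\<close> increasing to the left of it, against \<open>u(\<alpha>\<^sup>+) = 1\<close>.\<close>

lemma travelling_wave_deriv_neg:
  assumes d_pos: "\<And>v. v \<in> {0<..<1} \<Longrightarrow> 0 < d v"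
    and \<rho>_pos: "\<And>v. v \<in> {0<..<1} \<Longrightarrow> 0 < \<rho> v"
    and wave: "travelling_wave p d f g \<rho> c \<alpha> \<beta> u"
    and t0: "t0 \<in> einterval \<alpha> \<beta>"
  shows "deriv u t0 < 0"
proof (rule ccontr)
  assume "\<not> deriv u t0 < 0"
  let ?I = "einterval \<alpha> \<beta>" and ?\<phi> = "flux p d u"
  have u_der: "(u has_real_derivative deriv u t) (at t)" if "t \<in> ?I" for t
    using wave that by (auto simp: travelling_wave_def C1_differentiable_on_eq
        DERIV_deriv_iff_real_differentiable)
  have \<phi>_der: "(?\<phi> has_real_derivative deriv ?\<phi> t) (at t)" if "t \<in> ?I" for t
    using wave that by (auto simp: travelling_wave_def C1_differentiable_on_eq
        DERIV_deriv_iff_real_differentiable)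
  have u_in: "u t \<in> {0<..<1}" if "t \<in> ?I" for t using wave that by (auto simp: travelling_wave_def)
  have sgn: "(?\<phi> t = 0 \<longleftrightarrow> deriv u t = 0) \<and> (0 < ?\<phi> t \<longleftrightarrow> 0 < deriv u t)" if "t \<in> ?I" for t
    using d_pos[OF u_in[OF that]]
    by (cases "deriv u t = 0") (auto simp: flux_def zero_less_mult_iff mult_less_0_iff)
  have zero: "deriv ?\<phi> t < 0" if "t \<in> ?I" "?\<phi> t = 0" for t
  proof -
    have "deriv ?\<phi> t + (c * g (u t) - f (u t)) * deriv u t + \<rho> (u t) = 0"
      using wave that by (auto simp: travelling_wave_def)
    then show ?thesis using sgn[OF that(1)] that \<rho>_pos[OF u_in[OF that(1)]] by auto
  qed
  note between = einterval_between[OF _ t0]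
  have \<phi>0: "0 \<le> ?\<phi> t0"
    using \<open>\<not> deriv u t0 < 0\<close> sgn[OF t0] by (auto simp: not_less le_less)
  have pos: "0 < ?\<phi> t" if t: "t \<in> ?I" "t < t0" for t
  proof (rule ccontr)
    assume "\<not> 0 < ?\<phi> t"
    \<comment> \<open>If the flux vanishes at \<open>t\<close>, its negative derivative there makes
      it negative immediately afterwards.\<close>
    have "\<exists>t1. t \<le> t1 \<and> t1 < t0 \<and> ?\<phi> t1 < 0"
    proof (cases "?\<phi> t = 0")
      case True
      then obtain e where e: "e > 0" "\<And>h. h > 0 \<Longrightarrow> h < e \<Longrightarrow> ?\<phi> t > ?\<phi> (t + h)"
        using DERIV_neg_dec_right[OF \<phi>_der[OF t(1)] zero[OF t(1)]] by auto
      define h where "h = min e (t0 - t) / 2"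
      have "h > 0" "h < e" "h < t0 - t" using e(1) t(2) by (auto simp: h_def min_def)
      then show ?thesis using e(2)[of h] True by (intro exI[of _ "t + h"]) auto
    next
      case False
      then show ?thesis using \<open>\<not> 0 < ?\<phi> t\<close> t by (intro exI[of _ t]) auto
    qed
    then obtain t1 where t1: "t \<le> t1" "t1 < t0" "?\<phi> t1 < 0" by blast
    have cont: "continuous_on {t1..t0} ?\<phi>"
      using between[OF t(1)] t1 by (intro continuous_at_imp_continuous_on ballI)
        (meson DERIV_isCont \<phi>_der atLeastAtMost_iff order_trans)
    define S where "S = {x\<in>{t1..t0}. 0 \<le> ?\<phi> x}"
    have "closed S"
      unfolding S_def using continuous_closed_preimage[OF cont, of "{0..}"]
      by (simp add: vimage_def Int_def)
    moreover have "bdd_below S" by (auto simp: S_def)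
    moreover have "t0 \<in> S" using \<phi>0 t1 by (auto simp: S_def)
    ultimately have inS: "Inf S \<in> S" by (intro closed_contains_Inf) auto
    \<comment> \<open>First return of the flux to nonnegative values after \<open>t1\<close>. It is
      0 there with negative derivative, hence positive just before, where it should still be
      negative.\<close>
    define s where "s = Inf S"
    have s: "t1 \<le> s" "s \<le> t0" "0 \<le> ?\<phi> s" using inS by (auto simp: S_def s_def)
    then have "t1 < s" using t1 by (cases "t1 = s") auto
    have before: "?\<phi> x < 0" if "t1 \<le> x" "x < s" for x
    proof (rule ccontr)
      assume "\<not> ?\<phi> x < 0"
      then have "x \<in> S" using that s by (auto simp: S_def)
      then have "s \<le> x" unfolding s_def using \<open>bdd_below S\<close> by (rule cInf_lower)
      with that show False by simp
    qed
    have "s \<in> ?I" using between[OF t(1)] t1 s by auto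
    obtain z where z: "t1 \<le> z" "z \<le> s" "?\<phi> z = 0"
      using IVT'[of ?\<phi> t1 0 s] t1 s continuous_on_subset[OF cont, of "{t1..s}"] by auto
    then have "?\<phi> s = 0" using before[of z] by (cases "z = s") auto
    then obtain e where e: "e > 0" "\<And>h. h > 0 \<Longrightarrow> h < e \<Longrightarrow> ?\<phi> s < ?\<phi> (s - h)"
      using DERIV_neg_dec_left[OF \<phi>_der zero] \<open>s \<in> ?I\<close> by blast
    define h where "h = min e (s - t1) / 2"
    have "h > 0" "h < e" "h < s - t1" using e(1) \<open>t1 < s\<close> by (auto simp: h_def min_def)
    then show False using e(2)[of h] before[of "s - h"] \<open>?\<phi> s = 0\<close> by auto
  qed
  have "\<alpha> < ereal t0" using t0 by (auto simp: einterval_def)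
  then obtain t1 where t1: "\<alpha> < ereal t1" "t1 < t0" using ereal_dense2[of \<alpha> "ereal t0"] by auto
  have "t1 \<in> ?I"
    using t1 t0 less_trans[of "ereal t1" "ereal t0" \<beta>] by (auto simp: einterval_def)
  have "\<forall>\<^sub>F x in at_right \<alpha>. u t1 < (u \<circ> real_of_ereal) x"
    by (rule order_tendstoD(1)[of "u \<circ> real_of_ereal" 1])
      (use wave u_in[OF \<open>t1 \<in> ?I\<close>] in \<open>auto simp: travelling_wave_def\<close>)
  then obtain b where b: "\<alpha> < b" "\<And>x. \<alpha> < x \<Longrightarrow> x < b \<Longrightarrow> u t1 < (u \<circ> real_of_ereal) x"
    using eventually_at_right[OF t1(1)] by auto
  obtain t where t: "\<alpha> < ereal t" "ereal t < min b (ereal t1)"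
    using ereal_dense2[of \<alpha> "min b (ereal t1)"] b t1 by auto
  have "t \<in> ?I"
    using t \<open>t1 \<in> ?I\<close> less_trans[of "ereal t" "ereal t1" \<beta>] by (auto simp: einterval_def)
  have "u t \<le> u t1"
  proof (rule DERIV_nonneg_imp_nondecreasing[of t t1 u])
    show "t \<le> t1" using t by simp
    fix x assume "t \<le> x" "x \<le> t1"
    then have "x \<in> ?I" "x < t0" using between[OF \<open>t \<in> ?I\<close>] t1 by auto
    then show "\<exists>y. (u has_real_derivative y) (at x) \<and> 0 \<le> y"
      using u_der pos sgn by (meson less_imp_le)
  qed
  with b(2)[of "ereal t"] t show False by auto
qed

text \<open>\<open>T\<close> is the inverse function of the wave. It is returned along with
  \<open>y\<close> because T(v) tends to \<open>\<beta>\<close> as v tends to 0: finiteness of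
  \<open>\<beta>\<close> becomes boundedness of an antiderivative of -(d / y)^q, and the limit of u'
  becomes a question about y / d at 0.\<close>

lemma travelling_wave_profile:
  assumes "1 < p" and q: "q = 1 / (p - 1)"
    and d_pos: "\<And>v. v \<in> {0<..<1} \<Longrightarrow> 0 < d v"
    and \<rho>_pos: "\<And>v. v \<in> {0<..<1} \<Longrightarrow> 0 < \<rho> v"
    and wave: "travelling_wave p d f g \<rho> c \<alpha> \<beta> u"
  obtains T y where
    "\<And>v. v \<in> {0<..<1} \<Longrightarrow> (T has_real_derivative - ((d v / y v) powr q)) (at v)"
    "filterlim (\<lambda>v. ereal (T v)) (at_left \<beta>) (at_right 0)"
    "filterlim (u \<circ> real_of_ereal) (at_right 0) (at_left \<beta>)"
    "\<forall>\<^sub>F x in at_left \<beta>. (deriv u \<circ> real_of_ereal) x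
      = - ((y ((u \<circ> real_of_ereal) x) / d ((u \<circ> real_of_ereal) x)) powr q)"
    "\<And>v. v \<in> {0<..<1} \<Longrightarrow> 0 < y v"
    "\<And>v. v \<in> {0<..<1} \<Longrightarrow>
      (y has_real_derivative c * g v - f v - \<rho> v * d v powr q * y v powr - q) (at v)"
    "(y \<longlongrightarrow> 0) (at_right 0)" "(y \<longlongrightarrow> 0) (at_left 1)"
proof -
  let ?I = "einterval \<alpha> \<beta>" and ?\<phi> = "flux p d u"
  have "\<alpha> < \<beta>" using wave by (simp add: travelling_wave_def)
  have qp: "q * (p - 1) = 1" "q > 0" using q \<open>1 < p\<close> by auto
  have u_der: "(u has_real_derivative deriv u t) (at t)" if "t \<in> ?I" for t
    using wave that by (auto simp: travelling_wave_def C1_differentiable_on_eq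
        DERIV_deriv_iff_real_differentiable)
  have \<phi>_der: "(?\<phi> has_real_derivative deriv ?\<phi> t) (at t)" if "t \<in> ?I" for t
    using wave that by (auto simp: travelling_wave_def C1_differentiable_on_eq
        DERIV_deriv_iff_real_differentiable)
  have u_in: "u t \<in> {0<..<1}" if "t \<in> ?I" for t using wave that by (auto simp: travelling_wave_def)
  have u_neg: "deriv u t < 0" if "t \<in> ?I" for t
    using travelling_wave_deriv_neg[OF d_pos \<rho>_pos wave that] by simp
  note between = einterval_between[of _ \<alpha> \<beta>]
  have u_dec: "u t < u s" if "s \<in> ?I" "t \<in> ?I" "s < t" for s t
    using that(3) by (rule DERIV_neg_imp_decreasing) (use u_der u_neg between[OF that(1,2)] in blast)
  have u_cont: "continuous_on ?I u"
    using u_der by (meson DERIV_isCont continuous_at_imp_continuous_on)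
  \<comment> \<open>The end points are extended reals, so an eventual property first has to be
    turned into a real witness inside the domain; this is the substitute for picking a point close
    to an end, finite or not.\<close>
  have near_\<alpha>: "\<exists>t\<in>?I. P (ereal t)" if "eventually P (at_right \<alpha>)" for P
  proof -
    obtain b where "\<alpha> < b" "\<And>x. \<alpha> < x \<Longrightarrow> x < b \<Longrightarrow> P x"
      using \<open>eventually P _\<close> eventually_at_right[OF \<open>\<alpha> < \<beta>\<close>] by auto
    moreover obtain t where "\<alpha> < ereal t" "ereal t < min b \<beta>"
      using ereal_dense2[of \<alpha> "min b \<beta>"] \<open>\<alpha> < b\<close> \<open>\<alpha> < \<beta>\<close> by auto
    ultimately show ?thesis by (auto simp: einterval_def)
  qed
  have near_\<beta>: "\<exists>t\<in>?I. P (ereal t)" if "eventually P (at_left \<beta>)" for P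
  proof -
    obtain b where "b < \<beta>" "\<And>x. b < x \<Longrightarrow> x < \<beta> \<Longrightarrow> P x"
      using \<open>eventually P _\<close> eventually_at_left[OF \<open>\<alpha> < \<beta>\<close>] by auto
    moreover obtain t where "max b \<alpha> < ereal t" "ereal t < \<beta>"
      using ereal_dense2[of "max b \<alpha>" \<beta>] \<open>b < \<beta>\<close> \<open>\<alpha> < \<beta>\<close> by auto
    ultimately show ?thesis by (auto simp: einterval_def)
  qed
  have surj: "\<exists>t\<in>?I. u t = v" if v: "v \<in> {0<..<1}" for v
  proof -
    obtain s where s: "s \<in> ?I" "v < u s"
      using near_\<alpha>[OF order_tendstoD(1)[of "u \<circ> real_of_ereal" 1 "at_right \<alpha>" v]] wave v
      by (auto simp: travelling_wave_def)
    obtain t where t: "t \<in> ?I" "u t < v"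
      using near_\<beta>[OF order_tendstoD(2)[of "u \<circ> real_of_ereal" 0 "at_left \<beta>" v]] wave v
      by (auto simp: travelling_wave_def)
    have "s < t" using u_dec[OF t(1) s(1)] s t by (cases s t rule: linorder_cases) auto
    have "{s..t} \<subseteq> ?I" using between[OF s(1) t(1)] by auto
    then obtain x where "s \<le> x" "x \<le> t" "u x = v"
      using IVT2'[of u t v s] s t \<open>s < t\<close> continuous_on_subset[OF u_cont] by auto
    then show ?thesis using \<open>{s..t} \<subseteq> ?I\<close> by auto
  qed
  define T where "T = inv_into ?I u"
  have T_in: "T v \<in> ?I" and u_T: "u (T v) = v" if "v \<in> {0<..<1}" for v
    using surj[OF that] unfolding T_def by (auto intro!: inv_into_into f_inv_into_f)
  have "inj_on u ?I"
    by (rule linorder_inj_onI') (use u_dec in force)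
  then have T_u: "T (u t) = t" if "t \<in> ?I" for t
    unfolding T_def using that by simp
  have T_der: "(T has_real_derivative inverse (deriv u (T v))) (at v)" if v: "v \<in> {0<..<1}" for v
    unfolding has_field_derivative_def
  proof (rule has_derivative_inverse_strong_x[where f = u and S = ?I])
    show "(u has_derivative (*) (deriv u (T v))) (at (T v))"
      using u_der[OF T_in[OF v]] by (simp add: has_field_derivative_def)
    show "(*) (deriv u (T v)) \<circ> (*) (inverse (deriv u (T v))) = id"
      using u_neg[OF T_in[OF v]] by (auto simp: fun_eq_iff)
  qed (use T_in[OF v] u_T[OF v] u_cont T_u in auto)
  define y where "y v = - ?\<phi> (T v)" for v
  have y_eq: "y v = d v * (- deriv u (T v)) powr (p - 1)" if "v \<in> {0<..<1}" for v
    using flux_decreasing[OF u_neg[OF T_in[OF that]]] that by (simp add: y_def u_T)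
  have y_pos: "0 < y v" if "v \<in> {0<..<1}" for v
    using d_pos[OF that] u_neg[OF T_in[OF that]] by (simp add: y_eq[OF that])
  have yd: "(y v / d v) powr q = - deriv u (T v)" if "v \<in> {0<..<1}" for v
    using d_pos[OF that] u_neg[OF T_in[OF that]] qp by (simp add: y_eq[OF that] powr_powr mult.commute)
  have dy: "(d v / y v) powr q = - inverse (deriv u (T v))" if "v \<in> {0<..<1}" for v
    using arg_cong[OF yd[OF that], of inverse] d_pos[OF that] y_pos[OF that]
    by (simp add: powr_divide inverse_eq_divide)
  have y_der: "(y has_real_derivative c * g v - f v - \<rho> v * d v powr q * y v powr - q) (at v)"
    if v: "v \<in> {0<..<1}" for v
  proof -
    \<comment> \<open>The chain rule gives y' = -(flux)' / u' at T(v). Dividing the wave equation by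
      u' < 0 eliminates the flux.\<close>
    have "(y has_real_derivative - (deriv ?\<phi> (T v) * inverse (deriv u (T v)))) (at v)"
      unfolding y_def by (rule DERIV_minus[OF DERIV_chain2[OF \<phi>_der[OF T_in[OF v]] T_der[OF v]]])
    moreover have "deriv ?\<phi> (T v) + (c * g v - f v) * deriv u (T v) + \<rho> v = 0"
      using wave T_in[OF v] u_T[OF v] by (force simp: travelling_wave_def)
    then have "- (deriv ?\<phi> (T v) * inverse (deriv u (T v)))
        = c * g v - f v + \<rho> v * inverse (deriv u (T v))"
      using u_neg[OF T_in[OF v]] by (simp add: field_simps)
    moreover have "\<rho> v * inverse (deriv u (T v)) = - (\<rho> v * d v powr q * y v powr - q)"
      using arg_cong[OF dy[OF v], of "\<lambda>x. \<rho> v * x"] d_pos[OF v] y_pos[OF v]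
      by (simp add: powr_divide powr_minus_divide)
    ultimately show ?thesis by simp
  qed
  have T_left: "filterlim (\<lambda>v. ereal (T v)) (at_left \<beta>) (at_right 0)"
    unfolding filterlim_iff
  proof (intro allI impI)
    fix P assume "eventually P (at_left \<beta>)"
    then obtain b where b: "b < \<beta>" "\<And>x. b < x \<Longrightarrow> x < \<beta> \<Longrightarrow> P x"
      using eventually_at_left[OF \<open>\<alpha> < \<beta>\<close>] by auto
    then have "eventually (\<lambda>x. b < x) (at_left \<beta>)"
      using eventually_at_left[OF \<open>\<alpha> < \<beta>\<close>] by auto
    then obtain t where t: "t \<in> ?I" "b < ereal t" using near_\<beta> by blast
    show "\<forall>\<^sub>F v in at_right 0. P (ereal (T v))"
      unfolding eventually_at_right[OF zero_less_one]
    proof (intro exI[of _ "u t"] conjI allI impI)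
      show "0 < u t" using u_in[OF t(1)] by simp
      fix v assume v: "0 < v" "v < u t"
      then have v1: "v \<in> {0<..<1}" using u_in[OF t(1)] by auto
      have "t < T v"
        using u_dec[OF T_in[OF v1] t(1)] u_T[OF v1] v by (cases t "T v" rule: linorder_cases) auto
      then have "b < ereal (T v)" using t less_trans[of b "ereal t" "ereal (T v)"] by auto
      then show "P (ereal (T v))" using T_in[OF v1] by (intro b) (auto simp: einterval_def)
    qed
  qed
  have T_right: "filterlim (\<lambda>v. ereal (T v)) (at_right \<alpha>) (at_left 1)"
    unfolding filterlim_iff
  proof (intro allI impI)
    fix P assume "eventually P (at_right \<alpha>)"
    then obtain b where b: "\<alpha> < b" "\<And>x. \<alpha> < x \<Longrightarrow> x < b \<Longrightarrow> P x"
      using eventually_at_right[OF \<open>\<alpha> < \<beta>\<close>] by auto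
    then have "eventually (\<lambda>x. x < b) (at_right \<alpha>)"
      using eventually_at_right[OF \<open>\<alpha> < \<beta>\<close>] by auto
    then obtain t where t: "t \<in> ?I" "ereal t < b" using near_\<alpha> by blast
    show "\<forall>\<^sub>F v in at_left 1. P (ereal (T v))"
      unfolding eventually_at_left[OF zero_less_one]
    proof (intro exI[of _ "u t"] conjI allI impI)
      show "u t < 1" using u_in[OF t(1)] by simp
      fix v assume v: "u t < v" "v < 1"
      then have v1: "v \<in> {0<..<1}" using u_in[OF t(1)] by auto
      have "T v < t"
        using u_dec[OF t(1) T_in[OF v1]] u_T[OF v1] v by (cases t "T v" rule: linorder_cases) auto
      then have "ereal (T v) < b" using t less_trans[of "ereal (T v)" "ereal t" b] by auto
      then show "P (ereal (T v))" using T_in[OF v1] by (intro b) (auto simp: einterval_def)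
    qed
  qed
  have ev_in: "\<forall>\<^sub>F x in at_left \<beta>. \<alpha> < x \<and> x < \<beta>"
    unfolding eventually_at_left[OF \<open>\<alpha> < \<beta>\<close>] using \<open>\<alpha> < \<beta>\<close> by auto
  have in_I: "real_of_ereal x \<in> ?I" if "\<alpha> < x \<and> x < \<beta>" for x
    using that by (cases x) (auto simp: einterval_def)
  show ?thesis
  proof (rule that[of T y])
    show "(T has_real_derivative - ((d v / y v) powr q)) (at v)" if "v \<in> {0<..<1}" for v
      using T_der[OF that] by (simp add: dy[OF that])
    show "filterlim (u \<circ> real_of_ereal) (at_right 0) (at_left \<beta>)"
    proof (rule tendsto_imp_filterlim_at_right)
      show "((u \<circ> real_of_ereal) \<longlongrightarrow> 0) (at_left \<beta>)" using wave by (simp add: travelling_wave_def)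
      show "\<forall>\<^sub>F x in at_left \<beta>. 0 < (u \<circ> real_of_ereal) x"
        using ev_in by eventually_elim (use in_I u_in in auto)
    qed
    show "\<forall>\<^sub>F x in at_left \<beta>. (deriv u \<circ> real_of_ereal) x
      = - ((y ((u \<circ> real_of_ereal) x) / d ((u \<circ> real_of_ereal) x)) powr q)"
      using ev_in
    proof eventually_elim
      case (elim x)
      then show ?case using yd[OF u_in[OF in_I]] T_u[OF in_I] by simp
    qed
    have "((?\<phi> \<circ> real_of_ereal) \<longlongrightarrow> 0) (at_left \<beta>)" "((?\<phi> \<circ> real_of_ereal) \<longlongrightarrow> 0) (at_right \<alpha>)"
      using wave by (auto simp: travelling_wave_def)
    from tendsto_minus[OF filterlim_compose[OF this(1) T_left]]
      tendsto_minus[OF filterlim_compose[OF this(2) T_right]]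
    show "(y \<longlongrightarrow> 0) (at_right 0)" "(y \<longlongrightarrow> 0) (at_left 1)"
      by (simp_all add: y_def[abs_def])
  qed (fact T_left y_pos y_der)+
qed

text \<open>Time is recovered by separating variables in u' = -(y / d)^q: the wave is the inverse of
  an antiderivative of -(d / y)^q, and its end points are the infimum and supremum of that
  antiderivative. The lemma serves to produce waves that contradict the minimality of a
  speed.\<close>

lemma profile_travelling_wave:
  assumes "1 < p" and q: "q = 1 / (p - 1)"
    and cont: "continuous_on {0<..<1} d" "continuous_on {0<..<1} f" "continuous_on {0<..<1} g"
      "continuous_on {0<..<1} \<rho>"
    and d_pos: "\<And>v. v \<in> {0<..<1} \<Longrightarrow> 0 < d v"
    and y_pos: "\<And>v. v \<in> {0<..<1} \<Longrightarrow> 0 < y v"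
    and y_der: "\<And>v. v \<in> {0<..<1} \<Longrightarrow>
      (y has_real_derivative c * g v - f v - \<rho> v * d v powr q * y v powr - q) (at v)"
    and y_lim: "(y \<longlongrightarrow> 0) (at_right 0)" "(y \<longlongrightarrow> 0) (at_left 1)"
  shows "\<exists>\<alpha> \<beta> u. travelling_wave p d f g \<rho> c \<alpha> \<beta> u"
proof -
  let ?J = "{0<..<1::real}"
  have qp: "q * (p - 1) = 1" "q > 0" using q \<open>1 < p\<close> by auto
  have y_cont: "continuous_on ?J y"
    using y_der by (meson DERIV_isCont continuous_at_imp_continuous_on)
  define w where "w v = - ((d v / y v) powr q)" for v
  have w_neg: "w v < 0" if "v \<in> ?J" for v
    using d_pos[OF that] y_pos[OF that] by (simp add: w_def)
  have w_cont: "continuous_on ?J w"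
    unfolding w_def using d_pos y_pos by (intro continuous_intros cont y_cont) force+
  have "isCont w v" if "(0::ereal) < ereal v" "ereal v < 1" for v
    using w_cont that by (simp add: continuous_on_eq_continuous_at zero_ereal_def one_ereal_def)
  \<comment> \<open>The integrand may fail to be integrable at 0 or at 1, so the antiderivative
    lives on the open interval; its divergence at an end is exactly an infinite end point of the
    wave.\<close>
  then obtain T where "\<forall>x. 0 < ereal x \<longrightarrow> ereal x < 1 \<longrightarrow> (T has_vector_derivative w x) (at x)"
    using einterval_antiderivative[of 0 1 w] by auto
  then have T_der: "(T has_real_derivative w v) (at v)" if "v \<in> ?J" for v
    using that by (simp add: has_real_derivative_iff_has_vector_derivative zero_ereal_def one_ereal_def)
  have T_dec: "T z < T v" if "v \<in> ?J" "z \<in> ?J" "v < z" for v z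
    by (rule DERIV_neg_imp_decreasing[OF that(3)]) (use T_der w_neg that in force)
  have T_cont: "continuous_on ?J T"
    using T_der by (meson DERIV_isCont continuous_at_imp_continuous_on)
  have T_inj: "inj_on T ?J" by (rule linorder_inj_onI') (use T_dec in force)
  define u where "u = inv_into ?J T"
  have u_T: "u (T v) = v" if "v \<in> ?J" for v
    using T_inj that by (simp add: u_def)
  define \<alpha> \<beta> where "\<alpha> = (INF v\<in>?J. ereal (T v))" and "\<beta> = (SUP v\<in>?J. ereal (T v))"
  let ?I = "einterval \<alpha> \<beta>"
  have T_in: "T v \<in> ?I" if v: "v \<in> ?J" for v
  proof -
    have m: "(v + 1) / 2 \<in> ?J" "v / 2 \<in> ?J" "v / 2 < v" "v < (v + 1) / 2" using v by auto
    have le: "\<alpha> \<le> ereal (T ((v + 1) / 2))" "ereal (T (v / 2)) \<le> \<beta>"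
      unfolding \<alpha>_def \<beta>_def using m by (auto intro!: INF_lower SUP_upper)
    have less: "ereal (T ((v + 1) / 2)) < ereal (T v)" "ereal (T v) < ereal (T (v / 2))"
      using T_dec m v by auto
    show ?thesis
      using le_less_trans[OF le(1) less(1)] less_le_trans[OF less(2) le(2)]
      by (simp add: einterval_def)
  qed
  have T_surj: "\<exists>v\<in>?J. T v = t" if t: "t \<in> ?I" for t
  proof -
    obtain v z where vz: "v \<in> ?J" "T v < t" "z \<in> ?J" "t < T z"
      using t by (auto simp: einterval_def \<alpha>_def \<beta>_def INF_less_iff less_SUP_iff)
    have "z < v" using T_dec[of v z] vz by (cases z v rule: linorder_cases) auto
    have "{z..v} \<subseteq> ?J" using vz by auto
    then obtain x where "z \<le> x" "x \<le> v" "T x = t"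
      using IVT2'[of T v t z] vz \<open>z < v\<close> continuous_on_subset[OF T_cont] by auto
    then show ?thesis using \<open>{z..v} \<subseteq> ?J\<close> by auto
  qed
  have "u t \<in> ?J \<and> T (u t) = t" if "t \<in> ?I" for t
    using T_surj[OF that] u_T by metis
  then have u_in: "u t \<in> ?J" and T_u: "T (u t) = t" if "t \<in> ?I" for t
    using that by blast+
  have u_der': "(u has_real_derivative inverse (w (u t))) (at t)" if t: "t \<in> ?I" for t
    unfolding has_field_derivative_def
  proof (rule has_derivative_inverse_strong_x[where f = T and S = ?J])
    show "(T has_derivative (*) (w (u t))) (at (u t))"
      using T_der[OF u_in[OF t]] by (simp add: has_field_derivative_def)
    show "(*) (w (u t)) \<circ> (*) (inverse (w (u t))) = id"
      using w_neg[OF u_in[OF t]] by (auto simp: fun_eq_iff)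
  qed (use T_u[OF t] u_in[OF t] T_cont u_T in auto)
  have wi: "inverse (w v) = - ((y v / d v) powr q)" if "v \<in> ?J" for v
    using d_pos[OF that] y_pos[OF that] by (simp add: w_def powr_divide inverse_eq_divide)
  have u_der: "(u has_real_derivative - ((y (u t) / d (u t)) powr q)) (at t)" if t: "t \<in> ?I" for t
    using u_der'[OF t] wi[OF u_in[OF t]] by simp
  have u_deriv: "deriv u t = - ((y (u t) / d (u t)) powr q)" if "t \<in> ?I" for t
    using u_der[OF that] by (rule DERIV_imp_deriv)
  have u_cont: "continuous_on ?I u"
    using u_der by (meson DERIV_isCont continuous_at_imp_continuous_on)
  have flux: "flux p d u t = - y (u t)" if t: "t \<in> ?I" for t
  proof -
    have "0 < (y (u t) / d (u t)) powr q"
      using d_pos[OF u_in[OF t]] y_pos[OF u_in[OF t]] by simp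
    then show ?thesis
      using flux_decreasing[of u t p d] u_deriv[OF t] d_pos[OF u_in[OF t]] y_pos[OF u_in[OF t]] qp
      by (simp add: powr_powr)
  qed
  let ?y' = "\<lambda>v. c * g v - f v - \<rho> v * d v powr q * y v powr - q"
  have flux_der: "(flux p d u has_real_derivative - (?y' (u t) * - ((y (u t) / d (u t)) powr q))) (at t)"
    if t: "t \<in> ?I" for t
  proof (rule has_field_derivative_transform_within_open[of "\<lambda>t. - y (u t)" _ _ ?I])
    show "((\<lambda>t. - y (u t)) has_real_derivative - (?y' (u t) * - ((y (u t) / d (u t)) powr q))) (at t)"
      by (rule DERIV_minus[OF DERIV_chain2[OF y_der[OF u_in[OF t]] u_der[OF t]]])
  qed (use t flux in auto)
  have comp: "continuous_on ?I (\<lambda>t. F (u t))" if "continuous_on ?J F" for F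
    by (rule continuous_on_compose2[OF that u_cont]) (use u_in in auto)
  have \<alpha>\<beta>: "\<alpha> < \<beta>"
    using T_in[of "1/2"] by (auto simp: einterval_def intro: less_trans)
  have real_in: "real_of_ereal x \<in> ?I \<and> ereal (real_of_ereal x) = x" if "\<alpha> < x" "x < \<beta>" for x
    using that by (cases x) (auto simp: einterval_def)
  have u_left: "filterlim (u \<circ> real_of_ereal) (at_right 0) (at_left \<beta>)"
    unfolding filterlim_iff
  proof (intro allI impI)
    fix P :: "real \<Rightarrow> bool" assume "eventually P (at_right 0)"
    then obtain b0 where b0: "0 < b0" "\<And>x. 0 < x \<Longrightarrow> x < b0 \<Longrightarrow> P x"
      unfolding eventually_at_right[OF zero_less_one] by blast
    define b where "b = min b0 (1/2)"
    have b: "b \<in> ?J" "b \<le> b0" using b0 by (auto simp: b_def)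
    have "\<alpha> < ereal (T b)" "ereal (T b) < \<beta>" using T_in[OF b(1)] by (auto simp: einterval_def)
    show "\<forall>\<^sub>F x in at_left \<beta>. P ((u \<circ> real_of_ereal) x)"
      unfolding eventually_at_left[OF \<alpha>\<beta>]
    proof (intro exI[of _ "ereal (T b)"] conjI allI impI)
      fix x assume x: "ereal (T b) < x" "x < \<beta>"
      then have r: "real_of_ereal x \<in> ?I" "ereal (real_of_ereal x) = x"
        using real_in[of x] \<open>\<alpha> < ereal (T b)\<close> by auto
      have "T b < T (u (real_of_ereal x))" using x r T_u[OF r(1)] by (metis less_ereal.simps(1))
      then have "u (real_of_ereal x) < b"
        using T_dec[OF b(1) u_in[OF r(1)]] by (cases b "u (real_of_ereal x)" rule: linorder_cases) auto
      then show "P ((u \<circ> real_of_ereal) x)" using b0(2) u_in[OF r(1)] b by auto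
    qed fact
  qed
  have u_right: "filterlim (u \<circ> real_of_ereal) (at_left 1) (at_right \<alpha>)"
    unfolding filterlim_iff
  proof (intro allI impI)
    fix P :: "real \<Rightarrow> bool" assume "eventually P (at_left 1)"
    then obtain b0 where b0: "b0 < 1" "\<And>x. b0 < x \<Longrightarrow> x < 1 \<Longrightarrow> P x"
      unfolding eventually_at_left[OF zero_less_one] by blast
    define b where "b = max b0 (1/2)"
    have b: "b \<in> ?J" "b0 \<le> b" using b0 by (auto simp: b_def)
    have "\<alpha> < ereal (T b)" "ereal (T b) < \<beta>" using T_in[OF b(1)] by (auto simp: einterval_def)
    show "\<forall>\<^sub>F x in at_right \<alpha>. P ((u \<circ> real_of_ereal) x)"
      unfolding eventually_at_right[OF \<alpha>\<beta>]
    proof (intro exI[of _ "ereal (T b)"] conjI allI impI)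
      fix x assume x: "\<alpha> < x" "x < ereal (T b)"
      then have r: "real_of_ereal x \<in> ?I" "ereal (real_of_ereal x) = x"
        using real_in[of x] \<open>ereal (T b) < \<beta>\<close> by auto
      have "T (u (real_of_ereal x)) < T b" using x r T_u[OF r(1)] by (metis less_ereal.simps(1))
      then have "b < u (real_of_ereal x)"
        using T_dec[OF u_in[OF r(1)] b(1)] by (cases b "u (real_of_ereal x)" rule: linorder_cases) auto
      then show "P ((u \<circ> real_of_ereal) x)" using b0(2) u_in[OF r(1)] b by auto
    qed fact
  qed
  have flux_lim: "((flux p d u \<circ> real_of_ereal) \<longlongrightarrow> 0) F"
    if "filterlim (u \<circ> real_of_ereal) G F" "(y \<longlongrightarrow> 0) G" "\<forall>\<^sub>F x in F. \<alpha> < x \<and> x < \<beta>" for F G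
  proof (rule Lim_transform_eventually)
    show "((\<lambda>x. - y ((u \<circ> real_of_ereal) x)) \<longlongrightarrow> 0) F"
      using tendsto_minus[OF filterlim_compose[OF that(2,1)]] by simp
    show "\<forall>\<^sub>F x in F. - y ((u \<circ> real_of_ereal) x) = (flux p d u \<circ> real_of_ereal) x"
      using that(3) by eventually_elim (use flux real_in in auto)
  qed
  have "travelling_wave p d f g \<rho> c \<alpha> \<beta> u"
    unfolding travelling_wave_def
  proof (intro conjI ballI \<alpha>\<beta>)
    show "u C1_differentiable_on ?I"
      unfolding C1_differentiable_on_def
    proof (intro exI conjI ballI)
      show "(u has_vector_derivative - ((y (u t) / d (u t)) powr q)) (at t)" if "t \<in> ?I" for t
        using u_der[OF that] by (simp add: has_real_derivative_iff_has_vector_derivative)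
      show "continuous_on ?I (\<lambda>t. - ((y (u t) / d (u t)) powr q))"
        by (rule comp) (use d_pos y_pos in \<open>intro continuous_intros cont y_cont; force\<close>)
    qed
    show "flux p d u C1_differentiable_on ?I"
      unfolding C1_differentiable_on_def
    proof (intro exI conjI ballI)
      show "(flux p d u has_vector_derivative - (?y' (u t) * - ((y (u t) / d (u t)) powr q))) (at t)"
        if "t \<in> ?I" for t
        using flux_der[OF that] by (simp add: has_real_derivative_iff_has_vector_derivative)
      show "continuous_on ?I (\<lambda>t. - (?y' (u t) * - ((y (u t) / d (u t)) powr q)))"
        by (rule comp) (use d_pos y_pos in \<open>intro continuous_intros cont y_cont; force\<close>)
    qed
    fix t assume t: "t \<in> ?I"
    show "0 < u t" "u t < 1" using u_in[OF t] by auto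
    have "d (u t) powr q * y (u t) powr - q * (y (u t) / d (u t)) powr q = 1"
      using d_pos[OF u_in[OF t]] y_pos[OF u_in[OF t]] by (simp add: powr_divide powr_minus_divide)
    then have "\<rho> (u t) * d (u t) powr q * y (u t) powr - q * (y (u t) / d (u t)) powr q = \<rho> (u t)"
      by (simp add: mult.assoc)
    then show "deriv (flux p d u) t + (c * g (u t) - f (u t)) * deriv u t + \<rho> (u t) = 0"
      unfolding DERIV_imp_deriv[OF flux_der[OF t]] u_deriv[OF t] by (simp add: algebra_simps)
  next
    show "((u \<circ> real_of_ereal) \<longlongrightarrow> 1) (at_right \<alpha>)"
      using u_right by (simp add: filterlim_at)
    show "((u \<circ> real_of_ereal) \<longlongrightarrow> 0) (at_left \<beta>)"
      using u_left by (simp add: filterlim_at)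
    show "((flux p d u \<circ> real_of_ereal) \<longlongrightarrow> 0) (at_right \<alpha>)"
      by (rule flux_lim[OF u_right y_lim(2)]) (use \<alpha>\<beta> in \<open>auto simp: eventually_at_right[OF \<alpha>\<beta>]\<close>)
    show "((flux p d u \<circ> real_of_ereal) \<longlongrightarrow> 0) (at_left \<beta>)"
      by (rule flux_lim[OF u_left y_lim(1)]) (use \<alpha>\<beta> in \<open>auto simp: eventually_at_left[OF \<alpha>\<beta>]\<close>)
  qed
  then show ?thesis by blast
qed

section \<open>Profiles near zero\<close>

text \<open>Taking b < 1 keeps (0, b) within the interval on which the equation and the positivity
  assumptions hold.\<close>

lemma eventually_at_right_0:
  "eventually P (at_right (0::real)) \<longleftrightarrow> (\<exists>b. 0 < b \<and> b < 1 \<and> (\<forall>v. 0 < v \<longrightarrow> v < b \<longrightarrow> P v))"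
proof
  assume "eventually P (at_right 0)"
  then obtain b where "0 < b" "\<And>v. 0 < v \<Longrightarrow> v < b \<Longrightarrow> P v"
    unfolding eventually_at_right[OF zero_less_one] by blast
  then show "\<exists>b. 0 < b \<and> b < 1 \<and> (\<forall>v. 0 < v \<longrightarrow> v < b \<longrightarrow> P v)"
    by (intro exI[of _ "min b (1/2)"]) auto
qed (auto simp: eventually_at_right[OF zero_less_one])

text \<open>If \<open>y v1 < \<epsilon> v1\<close> for some small \<open>v1\<close>, this persists for the profile with a slightly smaller
  speed. As the line of slope \<open>\<epsilon>\<close> cannot be crossed, that profile tends to \<open>0\<close> at \<open>0\<close> and yields a
  wave slower than the threshold.\<close>

lemma profile_ge_linear_at_threshold:
  fixes f g \<rho> d y :: "real \<Rightarrow> real"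
  assumes "1 < p" and q: "q = 1 / (p - 1)"
    and cont: "continuous_on {0<..<1} d" "continuous_on {0..1} f" "continuous_on {0..1} g"
      "continuous_on {0..1} \<rho>"
    and d_pos: "\<And>v. v \<in> {0<..<1} \<Longrightarrow> 0 < d v"
    and \<rho>_pos: "\<And>v. v \<in> {0<..<1} \<Longrightarrow> 0 < \<rho> v"
    and y_pos: "\<And>v. v \<in> {0<..<1} \<Longrightarrow> 0 < y v"
    and y_der: "\<And>v. v \<in> {0<..<1} \<Longrightarrow>
      (y has_real_derivative c * g v - f v - \<rho> v * d v powr q * y v powr - q) (at v)"
    and y_lim: "(y \<longlongrightarrow> 0) (at_left 1)"
    and h_small: "((\<lambda>v. \<rho> v * d v powr q * v powr - q) \<longlongrightarrow> 0) (at_right 0)"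
    and thr: "threshold_speed p d f g \<rho> c"
    and a0: "f 0 < c * g 0"
  obtains \<epsilon> where "0 < \<epsilon>" "\<forall>\<^sub>F v in at_right 0. \<epsilon> * v \<le> y v"
proof -
  have "q > 0" using q \<open>1 < p\<close> by simp
  define a0 where "a0 = c * g 0 - f 0"
  \<comment> \<open>Budget in quarters of \<open>a0\<close>: near 0 the drift exceeds three of them,
    the reaction on or above the line of slope \<open>\<epsilon>\<close> and the change of speed
    cost at most one each, and the slope that remains exceeds \<open>\<epsilon>\<close>.\<close>
  define \<epsilon> where "\<epsilon> = a0 / 4"
  have "0 < a0" "0 < \<epsilon>" using a0 by (auto simp: a0_def \<epsilon>_def)
  let ?h = "\<lambda>v. \<rho> v * d v powr q"
  have sub: "{0<..<1} \<subseteq> {0..(1::real)}" by auto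
  have cont': "continuous_on {0<..<1} f" "continuous_on {0<..<1} g" "continuous_on {0<..<1} \<rho>"
    using cont continuous_on_subset[OF _ sub] by blast+
  have "\<forall>\<^sub>F v in at_right 0. \<epsilon> * v \<le> y v"
  proof (rule ccontr)
    assume contr: "\<not> (\<forall>\<^sub>F v in at_right 0. \<epsilon> * v \<le> y v)"
    \<comment> \<open>This is the reaction evaluated on the line y = \<epsilon> v.\<close>
    have "((\<lambda>v. ?h v * v powr - q * \<epsilon> powr - q) \<longlongrightarrow> 0 * \<epsilon> powr - q) (at_right 0)"
      by (intro tendsto_intros h_small)
    then have 1: "\<forall>\<^sub>F v in at_right 0. ?h v * v powr - q * \<epsilon> powr - q < a0 / 4"
      using \<open>0 < a0\<close> by (intro order_tendstoD(2)) auto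
    have "continuous_on {0..1} (\<lambda>v. c * g v - f v)" by (intro continuous_intros cont)
    then have "((\<lambda>v. c * g v - f v) \<longlongrightarrow> a0) (at_right 0)"
      unfolding a0_def by (rule continuous_on_Icc_at_rightD) simp
    then have 2: "\<forall>\<^sub>F v in at_right 0. 3 / 4 * a0 < c * g v - f v"
      using \<open>0 < a0\<close> by (intro order_tendstoD(1)) auto
    obtain v0 where v0: "0 < v0" "v0 < 1"
      "\<And>v. 0 < v \<Longrightarrow> v < v0 \<Longrightarrow> ?h v * v powr - q * \<epsilon> powr - q < a0 / 4"
      "\<And>v. 0 < v \<Longrightarrow> v < v0 \<Longrightarrow> 3 / 4 * a0 < c * g v - f v"
      using eventually_conj[OF 1 2] unfolding eventually_at_right_0 by blast
    obtain v1 where v1: "0 < v1" "v1 < v0" "y v1 < \<epsilon> * v1"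
      using contr v0 unfolding eventually_at_right_0 by (meson not_le)
    obtain G where "\<forall>z\<in>g ` {0..1}. norm z \<le> G"
      using compact_imp_bounded[OF compact_continuous_image[OF cont(3) compact_Icc]]
      unfolding bounded_iff by blast
    then have G: "\<bar>g v\<bar> \<le> G" if "v \<in> {0..1}" for v using that by auto
    \<comment> \<open>The first entry leaves the perturbed profile strictly below the line at
      \<open>v1\<close>; the second is the quarter of \<open>a0\<close> reserved for the change of
      speed.\<close>
    define K where "K = min (\<epsilon> * v1 - y v1) (a0 / 4) / 2"
    have "0 < K" "K < \<epsilon> * v1 - y v1" "K \<le> a0 / 4"
      using v1 \<open>0 < a0\<close> by (auto simp: K_def min_def)
    \<comment> \<open>Chosen so that \<tau> |g| \<le> K throughout [0, 1]; the 1 keeps the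
      denominator positive.\<close>
    define \<tau> where "\<tau> = K / (G + 1)"
    have "0 \<le> G" using G[of 0] by auto
    then have "0 < \<tau>" using \<open>0 < K\<close> by (simp add: \<tau>_def)
    have \<tau>g: "\<bar>\<tau> * g v\<bar> \<le> K" if "v \<in> {0..1}" for v
    proof -
      have "\<bar>\<tau> * g v\<bar> \<le> \<tau> * (G + 1)"
        using G[OF that] \<open>0 < \<tau>\<close> by (simp add: abs_mult)
      then show ?thesis using \<open>0 \<le> G\<close> by (simp add: \<tau>_def)
    qed
    obtain z where z_pos: "\<And>v. v \<in> {0<..<1} \<Longrightarrow> 0 < z v"
      and z_der: "\<And>v. v \<in> {0<..<1} \<Longrightarrow>
        (z has_real_derivative (c - \<tau>) * g v - f v - ?h v * z v powr - q) (at v)"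
      and z_y: "\<And>v. v \<in> {0<..<1} \<Longrightarrow> \<bar>z v - y v\<bar> \<le> K * (1 - v)"
    proof (rule perturbed_profile[of q K ?h "\<lambda>v. (c - \<tau>) * g v - f v" "\<lambda>v. c * g v - f v" y])
      show "continuous_on {0<..<1} ?h"
        using d_pos by (intro continuous_intros cont cont') force
      show "continuous_on {0<..<1} (\<lambda>v. (c - \<tau>) * g v - f v)" by (intro continuous_intros cont')
      show "\<bar>(c - \<tau>) * g v - f v - (c * g v - f v)\<bar> \<le> K" if "v \<in> {0<..<1}" for v
        using \<tau>g[of v] that by (simp add: algebra_simps)
      show "0 < ?h v" if "v \<in> {0<..<1}" for v using d_pos[OF that] \<rho>_pos[OF that] by simp
    qed (use \<open>0 < q\<close> \<open>0 < K\<close> y_pos y_der in auto)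
    \<comment> \<open>Above the line, z - \<epsilon> v is nondecreasing in v by the choice of
      \<open>\<epsilon>\<close>. A point above it to the left of \<open>v1\<close> would keep
      \<open>z\<close> above the line up to \<open>v1\<close>.\<close>
    have z_le: "z v \<le> \<epsilon> * v" if v: "0 < v" "v < v1" for v
    proof (rule ccontr)
      assume "\<not> z v \<le> \<epsilon> * v"
      have "\<epsilon> * v1 - z v1 \<le> \<epsilon> * v - z v"
      proof (rule negative_persists[of v v1 "\<lambda>x. \<epsilon> * x - z x"])
        show "continuous_on {v..v1} (\<lambda>x. \<epsilon> * x - z x)"
          using v v1 v0 z_der
          by (intro continuous_intros continuous_at_imp_continuous_on ballI DERIV_isCont[OF z_der]) auto
        fix x assume x: "v < x" "x < v1" "\<epsilon> * x - z x < 0"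
        then have x1: "x \<in> {0<..<1}" "0 < x" "x < v0" using v v1 v0 by auto
        have "z x powr - q \<le> (\<epsilon> * x) powr - q"
          using x x1 \<open>0 < \<epsilon>\<close> \<open>0 < q\<close> by (intro powr_mono2') auto
        then have "?h x * z x powr - q \<le> ?h x * (\<epsilon> * x) powr - q"
          using \<rho>_pos[OF x1(1)] by (intro mult_left_mono) auto
        also have "\<dots> = ?h x * x powr - q * \<epsilon> powr - q"
          using x1 \<open>0 < \<epsilon>\<close> by (simp add: powr_mult mult_ac)
        also have "\<dots> \<le> a0 / 4" using v0(3)[OF x1(2,3)] by simp
        finally have "?h x * z x powr - q \<le> a0 / 4" .
        moreover have "3 / 4 * a0 < c * g x - f x" using v0(4)[OF x1(2,3)] .
        moreover have "\<tau> * g x \<le> a0 / 4" using \<tau>g[of x] x1 \<open>K \<le> a0 / 4\<close> by auto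
        ultimately have "\<epsilon> - ((c - \<tau>) * g x - f x - ?h x * z x powr - q) \<le> 0"
          unfolding \<epsilon>_def left_diff_distrib by linarith
        moreover have "((\<lambda>x. \<epsilon> * x - z x) has_real_derivative
            \<epsilon> - ((c - \<tau>) * g x - f x - ?h x * z x powr - q)) (at x)"
          by (auto intro!: derivative_eq_intros z_der[OF x1(1)])
        ultimately show "\<exists>D\<le>0. ((\<lambda>x. \<epsilon> * x - z x) has_real_derivative D) (at x)" by blast
      qed (use v \<open>\<not> z v \<le> \<epsilon> * v\<close> in auto)
      moreover have "z v1 < \<epsilon> * v1"
      proof -
        have "z v1 \<le> y v1 + K * (1 - v1)" using z_y[of v1] v1 v0 by (auto simp: abs_le_iff)
        also have "\<dots> \<le> y v1 + K" using \<open>0 < K\<close> v1 by (simp add: algebra_simps)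
        finally show ?thesis using \<open>K < \<epsilon> * v1 - y v1\<close> by simp
      qed
      ultimately show False using \<open>\<not> z v \<le> \<epsilon> * v\<close> by simp
    qed
    have "(z \<longlongrightarrow> 0) (at_right 0)"
    proof (rule tendsto_sandwich[of "\<lambda>_. 0" _ _ "\<lambda>v. \<epsilon> * v"])
      have "0 \<le> z v" if "0 < v" "v < v1" for v using z_pos[of v] that v1 v0 by auto
      then show "\<forall>\<^sub>F v in at_right 0. 0 \<le> z v"
        unfolding eventually_at_right_0 using v1 v0 by (intro exI[of _ v1]) auto
      show "\<forall>\<^sub>F v in at_right 0. z v \<le> \<epsilon> * v"
        unfolding eventually_at_right_0 using z_le v1 v0 by (intro exI[of _ v1]) auto
      have "((\<lambda>v. \<epsilon> * v) \<longlongrightarrow> \<epsilon> * 0) (at_right 0)" by (intro tendsto_intros)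
      then show "((\<lambda>v. \<epsilon> * v) \<longlongrightarrow> 0) (at_right 0)" by simp
    qed simp
    moreover have "(z \<longlongrightarrow> 0) (at_left 1)"
    proof (rule tendsto_sandwich[of "\<lambda>_. 0" _ _ "\<lambda>v. y v + K * (1 - v)"])
      have ev: "\<forall>\<^sub>F v in at_left 1. v \<in> {0<..<(1::real)}"
        unfolding eventually_at_left[OF zero_less_one] by (intro exI[of _ 0]) auto
      show "\<forall>\<^sub>F v in at_left 1. 0 \<le> z v" using ev by eventually_elim (rule less_imp_le[OF z_pos])
      show "\<forall>\<^sub>F v in at_left 1. z v \<le> y v + K * (1 - v)"
        using ev
      proof eventually_elim
        case (elim v)
        show ?case using z_y[OF elim] unfolding abs_le_iff by linarith
      qed
      have "((\<lambda>v. y v + K * (1 - v)) \<longlongrightarrow> 0 + K * (1 - 1)) (at_left 1)" by (intro tendsto_intros y_lim)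
      then show "((\<lambda>v. y v + K * (1 - v)) \<longlongrightarrow> 0) (at_left 1)" by simp
    qed simp
    ultimately have "\<exists>\<alpha> \<beta> u. travelling_wave p d f g \<rho> (c - \<tau>) \<alpha> \<beta> u"
      using profile_travelling_wave[OF \<open>1 < p\<close> q cont(1) cont' d_pos z_pos z_der] by blast
    then have "c \<le> c - \<tau>" using thr unfolding threshold_speed_def by blast
    with \<open>0 < \<tau>\<close> show False by simp
  qed
  with \<open>0 < \<epsilon>\<close> that show ?thesis by blast
qed

section \<open>Bounds on profiles near 0 that do not use minimality of the speed\<close>

text \<open>Dropping the reaction, which only lowers the slope, makes y - B v nonincreasing with
  limit 0 at 0. The sign of \<open>B\<close> is left free: a negative \<open>B\<close> will exclude
  c g(0) < f(0), and arbitrarily small positive ones treat c g(0) = f(0).\<close>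

lemma profile_le_linear:
  fixes y A h :: "real \<Rightarrow> real"
  assumes y_der: "\<And>v. v \<in> {0<..<1} \<Longrightarrow> (y has_real_derivative A v - h v * y v powr - q) (at v)"
    and h: "\<And>v. v \<in> {0<..<1} \<Longrightarrow> 0 \<le> h v"
    and y_lim: "(y \<longlongrightarrow> 0) (at_right 0)"
    and B: "\<forall>\<^sub>F v in at_right 0. A v \<le> B"
  shows "\<forall>\<^sub>F v in at_right 0. y v \<le> B * v"
proof -
  obtain b where b: "0 < b" "b < 1" "\<And>v. 0 < v \<Longrightarrow> v < b \<Longrightarrow> A v \<le> B"
    using B unfolding eventually_at_right_0 by blast
  have "y v \<le> B * v" if v: "0 < v" "v < b" for v
  proof -
    have mono: "y v - B * v \<le> y w - B * w" if w: "0 < w" "w < v" for w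
    proof (rule DERIV_nonpos_imp_nonincreasing[of w v "\<lambda>x. y x - B * x"])
      fix x assume x: "w \<le> x" "x \<le> v"
      then have "x \<in> {0<..<1}" "A x \<le> B" using w v b by auto
      then show "\<exists>D. ((\<lambda>x. y x - B * x) has_real_derivative D) (at x) \<and> D \<le> 0"
        using mult_nonneg_nonneg[OF h[of x], of "y x powr - q"]
        by (intro exI[of _ "A x - h x * y x powr - q - B"])
          (auto intro!: derivative_eq_intros y_der)
    qed (use w in auto)
    have "y v - B * v \<le> 0"
    proof (rule tendsto_lowerbound)
      have "((\<lambda>w. y w - B * w) \<longlongrightarrow> 0 - B * 0) (at_right 0)" by (intro tendsto_intros y_lim)
      then show "((\<lambda>w. y w - B * w) \<longlongrightarrow> 0) (at_right 0)" by simp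
      show "\<forall>\<^sub>F w in at_right 0. y v - B * v \<le> y w - B * w"
        unfolding eventually_at_right_0 using mono v b by (intro exI[of _ v]) auto
    qed simp
    then show ?thesis by simp
  qed
  then show ?thesis unfolding eventually_at_right_0 using b by blast
qed

text \<open>The chord argument is applied on [v, 2 v] with starting height \<eta> v^(s / q). This
  exponent makes the reaction m v^s \<kappa>^(-q) independent of v, while q \<le> s keeps the height
  below v and the chord slope below 1; a small \<open>\<eta>\<close> then suffices for all small
  v.\<close>

lemma profile_ge_power:
  fixes y A h :: "real \<Rightarrow> real"
  assumes "0 < q" "q \<le> s" "0 < m"
    and y_pos: "\<And>v. v \<in> {0<..<1} \<Longrightarrow> 0 < y v"
    and y_der: "\<And>v. v \<in> {0<..<1} \<Longrightarrow> (y has_real_derivative A v - h v * y v powr - q) (at v)"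
    and M: "\<And>v. v \<in> {0<..<1} \<Longrightarrow> A v \<le> M"
    and h: "\<forall>\<^sub>F v in at_right 0. m * v powr s \<le> h v"
  obtains \<eta> where "0 < \<eta>" "\<forall>\<^sub>F v in at_right 0. \<eta> * v powr (s / q) \<le> y v"
proof -
  obtain b where b: "0 < b" "b < 1" "\<And>v. 0 < v \<Longrightarrow> v < b \<Longrightarrow> m * v powr s \<le> h v"
    using h unfolding eventually_at_right_0 by blast
  obtain \<eta> where \<eta>: "0 < \<eta>" "\<eta> \<le> 1" "M + 1 \<le> m * \<eta> powr - q"
    using powr_minus_ge_small[OF \<open>0 < q\<close> \<open>0 < m\<close> zero_less_one] by metis
  have "\<eta> * v powr (s / q) \<le> y v" if v: "0 < v" "v < b / 2" for v
  proof (rule strong_reaction_lower_bound[of v "2 * v" _ q y A h M "m * v powr s"])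
    have in01: "x \<in> {0<..<1}" "0 < x" "x < b" if "x \<in> {v..2 * v}" for x
      using that v b by auto
    show "continuous_on {v..2 * v} y"
      by (intro continuous_at_imp_continuous_on ballI DERIV_isCont[OF y_der] in01)
    show "0 < y x" if "x \<in> {v..2 * v}" for x using in01[OF that] y_pos by blast
    show "(y has_real_derivative A x - h x * y x powr - q) (at x)" if "x \<in> {v<..<2 * v}" for x
      using in01[of x] that by (intro y_der) auto
    show "A x \<le> M" if "x \<in> {v<..<2 * v}" for x using in01[of x] that by (intro M) auto
    show "m * v powr s \<le> h x" if "x \<in> {v<..<2 * v}" for x
    proof -
      have "m * v powr s \<le> m * x powr s"
        using that v assms by (intro mult_left_mono powr_mono2) auto
      then show ?thesis using b(3)[of x] in01[of x] that by auto
    qed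
    have "v powr (s / q) \<le> v powr 1"
      using v b assms by (intro powr_mono') auto
    then have "\<eta> * v powr (s / q) \<le> 1 * v"
      using \<eta> v by (intro mult_mono) auto
    then have "\<eta> * v powr (s / q) / (2 * v - v) \<le> 1" using v by simp
    moreover have "m * v powr s * (\<eta> * v powr (s / q)) powr - q = m * \<eta> powr - q"
      using \<eta> v \<open>0 < q\<close> by (simp add: powr_mult powr_powr powr_minus_divide)
    ultimately show "M + \<eta> * v powr (s / q) / (2 * v - v)
        \<le> m * v powr s * (\<eta> * v powr (s / q)) powr - q" using \<eta>(3) by linarith
  qed (use v \<eta> assms in auto)
  then have "\<forall>\<^sub>F v in at_right 0. \<eta> * v powr (s / q) \<le> y v"
    unfolding eventually_at_right_0 using b by (intro exI[of _ "b / 2"]) auto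
  with \<eta> that show ?thesis by blast
qed

section \<open>From power bounds to the behaviour of the antiderivative\<close>

lemma asymp_equiv_powr_bounds:
  fixes F :: "real \<Rightarrow> real"
  assumes "F \<sim>[at_right 0] (\<lambda>v. k * v powr e)" "0 < k"
  shows "\<forall>\<^sub>F v in at_right 0. k / 2 * v powr e \<le> F v \<and> F v \<le> 2 * k * v powr e"
proof -
  \<comment> \<open>The conditional is the convention 0 / 0 = 1 inside
    \<open>asymp_equiv_def\<close>; it is inactive here because the power is positive for v >
    0.\<close>
  have lim: "((\<lambda>v. if F v = 0 \<and> k * v powr e = 0 then 1 else F v / (k * v powr e)) \<longlongrightarrow> 1) (at_right 0)"
    using assms(1) by (simp add: asymp_equiv_def)
  have pos: "\<forall>\<^sub>F v in at_right 0. (0::real) < v" unfolding eventually_at_right_0 by (rule exI[of _ "1/2"]) auto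
  have "\<forall>\<^sub>F v in at_right 0. 1 / 2 < (if F v = 0 \<and> k * v powr e = 0 then 1 else F v / (k * v powr e))"
    "\<forall>\<^sub>F v in at_right 0. (if F v = 0 \<and> k * v powr e = 0 then 1 else F v / (k * v powr e)) < 2"
    by (rule order_tendstoD[OF lim]; simp)+
  then show ?thesis
    using pos
  proof eventually_elim
    case (elim v)
    then have "0 < k * v powr e" using \<open>0 < k\<close> by simp
    with elim have "1 / 2 < F v / (k * v powr e)" "F v / (k * v powr e) < 2" by (auto split: if_splits)
    with \<open>0 < k * v powr e\<close> show ?case by (simp add: field_simps)
  qed
qed

lemma antiderivative_bounded_near_0:
  fixes T \<phi> :: "real \<Rightarrow> real"
  assumes der: "\<And>v. v \<in> {0<..<1} \<Longrightarrow> (T has_real_derivative - \<phi> v) (at v)"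
    and \<phi>: "\<forall>\<^sub>F v in at_right 0. \<phi> v \<le> C * v powr - e" and "e < 1" "0 \<le> C"
  obtains B where "\<forall>\<^sub>F v in at_right 0. T v \<le> B"
proof -
  obtain b where b: "0 < b" "b < 1" "\<And>v. 0 < v \<Longrightarrow> v < b \<Longrightarrow> \<phi> v \<le> C * v powr - e"
    using \<phi> unfolding eventually_at_right_0 by blast
  \<comment> \<open>\<open>T\<close> plus an antiderivative of the majorant, hence nondecreasing; e
    < 1 makes the added term nonnegative, so that \<open>T\<close> inherits the bound.\<close>
  define W where "W x = T x + C / (1 - e) * x powr (1 - e)" for x
  have "T v \<le> W (b / 2)" if v: "0 < v" "v < b / 2" for v
  proof -
    have "W v \<le> W (b / 2)"
    proof (rule DERIV_nonneg_imp_nondecreasing[of v "b / 2" W])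
      fix x assume x: "v \<le> x" "x \<le> b / 2"
      then have x1: "x \<in> {0<..<1}" "0 < x" "x < b" using v b by auto
      have "(W has_real_derivative - \<phi> x + C * x powr - e) (at x)"
        unfolding W_def using x1 \<open>e < 1\<close> by (auto intro!: derivative_eq_intros der simp: powr_minus)
      then show "\<exists>D. (W has_real_derivative D) (at x) \<and> 0 \<le> D" using b(3)[of x] x1 by fastforce
    qed (use v in auto)
    moreover have "0 \<le> C / (1 - e) * v powr (1 - e)" using assms by simp
    ultimately show ?thesis by (simp add: W_def)
  qed
  then have "\<forall>\<^sub>F v in at_right 0. T v \<le> W (b / 2)"
    unfolding eventually_at_right_0 using b by (intro exI[of _ "b / 2"]) auto
  then show ?thesis by (rule that)
qed

lemma antiderivative_unbounded_near_0:
  fixes T \<phi> :: "real \<Rightarrow> real"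
  assumes der: "\<And>v. v \<in> {0<..<1} \<Longrightarrow> (T has_real_derivative - \<phi> v) (at v)"
    and \<phi>: "\<forall>\<^sub>F v in at_right 0. C * v powr - e \<le> \<phi> v" and "1 \<le> e" "0 < C"
  shows "filterlim T at_top (at_right 0)"
proof -
  obtain b where b: "0 < b" "b < 1" "\<And>v. 0 < v \<Longrightarrow> v < b \<Longrightarrow> C * v powr - e \<le> \<phi> v"
    using \<phi> unfolding eventually_at_right_0 by blast
  define W where "W x = T x + C * ln x" for x
  have "W (b / 2) - C * ln v \<le> T v" if v: "0 < v" "v < b / 2" for v
  proof -
    have "W (b / 2) \<le> W v"
    proof (rule DERIV_nonpos_imp_nonincreasing[of v "b / 2" W])
      fix x assume x: "v \<le> x" "x \<le> b / 2"
      then have x1: "x \<in> {0<..<1}" "0 < x" "x < b" using v b by auto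
      \<comment> \<open>On (0, 1) every exponent e \<ge> 1 dominates e = 1, so a logarithmic
        comparison covers them all.\<close>
      have "x powr - 1 \<le> x powr - e" using x1 \<open>1 \<le> e\<close> by (intro powr_mono') auto
      then have "C * x powr - 1 \<le> \<phi> x"
        using b(3)[OF x1(2,3)] \<open>0 < C\<close> by (meson mult_left_mono less_imp_le order_trans)
      then have "- \<phi> x + C / x \<le> 0" using x1 by (simp add: powr_minus_divide)
      moreover have "(W has_real_derivative - \<phi> x + C / x) (at x)"
        unfolding W_def using x1 by (auto intro!: derivative_eq_intros der)
      ultimately show "\<exists>D. (W has_real_derivative D) (at x) \<and> D \<le> 0" by blast
    qed (use v in auto)
    then show ?thesis by (simp add: W_def)
  qed
  then have ev: "\<forall>\<^sub>F v in at_right 0. W (b / 2) - C * ln v \<le> T v"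
    unfolding eventually_at_right_0 using b by (intro exI[of _ "b / 2"]) auto
  have "filterlim (\<lambda>v. W (b / 2) + C * - ln v) at_top (at_right 0)"
    by (intro filterlim_tendsto_add_at_top[OF tendsto_const]
        filterlim_tendsto_pos_mult_at_top[OF tendsto_const \<open>0 < C\<close>]
        filterlim_uminus_at_bot[THEN iffD1] ln_at_0)
  then show ?thesis
    using filterlim_at_top_mono ev by (simp add: filterlim_at_top_mono)
qed

section \<open>The end point of the critical wave\<close>

theorem corollary16:
  fixes p k1 k2 r \<delta> cstar :: real
    and f g \<rho> d u :: "real \<Rightarrow> real"
    and \<alpha> \<beta> :: ereal
  assumes "p > 1"
    and "continuous_on {0..1} f" and "continuous_on {0..1} g" and "continuous_on {0..1} \<rho>"
    and "d C1_differentiable_on {0<..<1}"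
    and "\<And>v. v \<in> {0<..<1} \<Longrightarrow> \<rho> v > 0" and "\<rho> 0 = 0" and "\<rho> 1 = 0"
    and "g 0 > 0" and "\<And>v. v \<in> {0<..1} \<Longrightarrow> integral {0..v} g > 0"
    and "\<And>v. v \<in> {0<..<1} \<Longrightarrow> d v > 0"
    and "set_integrable lborel {0<..<1} (\<lambda>v. \<rho> v * d v powr (1 / (p - 1)))"
    and "k1 > 0" and "k2 > 0" and "r > 0"
    and "d \<sim>[at_right 0] (\<lambda>v. k1 * v powr \<delta>)"
    and "\<rho> \<sim>[at_right 0] (\<lambda>v. k2 * v powr r)"
    and "r \<ge> (1 - \<delta>) / (p - 1)"
    and "threshold_speed p d f g \<rho> cstar"
    and "travelling_wave p d f g \<rho> cstar \<alpha> \<beta> u"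
  shows "(r < 1 \<longrightarrow> \<beta> < \<infinity>) \<and>
    (r = (1 - \<delta>) / (p - 1) \<and> r \<ge> 1 \<longrightarrow> \<beta> = \<infinity>) \<and>
    (r > (1 - \<delta>) / (p - 1) \<and> cstar * g 0 > f 0 \<longrightarrow>
       (\<beta> < \<infinity> \<longleftrightarrow> (1 - \<delta>) / (p - 1) < 1)) \<and>
    (\<beta> < \<infinity> \<longrightarrow>
       (\<delta> < 1 \<longrightarrow> ((deriv u \<circ> real_of_ereal) \<longlongrightarrow> 0) (at_left \<beta>)) \<and>
       (\<delta> = 1 \<longrightarrow>
          (((deriv u \<circ> real_of_ereal) \<longlongrightarrow> 0) (at_left \<beta>) \<longleftrightarrow> cstar * g 0 - f 0 = 0)) \<and>
       (\<delta> > 1 \<and> cstar * g 0 > f 0 \<longrightarrow>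
          filterlim (deriv u \<circ> real_of_ereal) at_bot (at_left \<beta>)))"
proof -
  note cont_f = assms(2) and cont_g = assms(3) and cont_\<rho> = assms(4) and d_C1 = assms(5)
    and \<rho>_pos = assms(6) and d_pos = assms(11) and ks = assms(13-15)
    and thr = assms(19) and wave = assms(20)
  define q where "q = 1 / (p - 1)"
  have "0 < q" using \<open>p > 1\<close> by (simp add: q_def)
  have div_q: "(1 - \<delta>) / (p - 1) = (1 - \<delta>) * q" by (simp add: q_def)
  \<comment> \<open>The order of \<rho> d^q at 0. The hypothesis on \<open>r\<close> says exactly q
    \<le> s, with equality in the balanced case.\<close>
  define s where "s = r + \<delta> * q"
  have "q \<le> s" using assms(18) by (simp add: s_def div_q algebra_simps)
  have d_cont: "continuous_on {0<..<1} d" by (rule C1_differentiable_imp_continuous_on[OF d_C1])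
  obtain T y where T_der: "\<And>v. v \<in> {0<..<1} \<Longrightarrow> (T has_real_derivative - ((d v / y v) powr q)) (at v)"
    and T_left: "filterlim (\<lambda>v. ereal (T v)) (at_left \<beta>) (at_right 0)"
    and u_left: "filterlim (u \<circ> real_of_ereal) (at_right 0) (at_left \<beta>)"
    and u_deriv: "\<forall>\<^sub>F x in at_left \<beta>. (deriv u \<circ> real_of_ereal) x
      = - ((y ((u \<circ> real_of_ereal) x) / d ((u \<circ> real_of_ereal) x)) powr q)"
    and y_pos: "\<And>v. v \<in> {0<..<1} \<Longrightarrow> 0 < y v"
    and y_der: "\<And>v. v \<in> {0<..<1} \<Longrightarrow>
      (y has_real_derivative cstar * g v - f v - \<rho> v * d v powr q * y v powr - q) (at v)"
    and y_lim: "(y \<longlongrightarrow> 0) (at_right 0)" "(y \<longlongrightarrow> 0) (at_left 1)"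
    using travelling_wave_profile[OF \<open>p > 1\<close> q_def d_pos \<rho>_pos wave] by blast
  let ?h = "\<lambda>v. \<rho> v * d v powr q" and ?A = "\<lambda>v. cstar * g v - f v"
  have A_cont: "continuous_on {0..1} ?A" by (intro continuous_intros cont_f cont_g)
  have A_lim: "(?A \<longlongrightarrow> cstar * g 0 - f 0) (at_right 0)"
    by (rule continuous_on_Icc_at_rightD[OF A_cont]) simp
  obtain M0 where "\<forall>z\<in>?A ` {0..1}. norm z \<le> M0"
    using compact_imp_bounded[OF compact_continuous_image[OF A_cont compact_Icc]]
    unfolding bounded_iff by blast
  then have M0: "\<bar>?A v\<bar> \<le> M0" if "v \<in> {0..1}" for v using that by auto
  \<comment> \<open>The 1 ensures M > 0, since M v will serve as a denominator.\<close>
  define M where "M = M0 + 1"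
  have "0 < M" using M0[of 0] by (simp add: M_def)
  have A_le: "?A v \<le> M" if "v \<in> {0<..<1}" for v
    using M0[of v] that by (auto simp: M_def abs_le_iff)
  have h_pos: "0 < ?h v" if "v \<in> {0<..<1}" for v using d_pos[OF that] \<rho>_pos[OF that] by simp
  have in01: "\<forall>\<^sub>F v in at_right 0. v \<in> {0<..<(1::real)}"
    unfolding eventually_at_right_0 by (intro exI[of _ "1/2"]) auto
  note d_bd = asymp_equiv_powr_bounds[OF assms(16) ks(1)]
  note \<rho>_bd = asymp_equiv_powr_bounds[OF assms(17) ks(2)]
  have h_bd: "\<forall>\<^sub>F v in at_right 0. k2 / 2 * (k1 / 2) powr q * v powr s \<le> ?h v \<and>
      ?h v \<le> 2 * k2 * (2 * k1) powr q * v powr s"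
    using d_bd \<rho>_bd in01
  proof eventually_elim
    case (elim v)
    have eq: "(C * v powr \<delta>) powr q = C powr q * v powr (\<delta> * q)" if "0 < C" for C
      using that elim by (simp add: powr_mult powr_powr)
    have "k2 / 2 * v powr r * (k1 / 2 * v powr \<delta>) powr q \<le> ?h v"
      using elim ks \<open>0 < q\<close> d_pos[of v] \<rho>_pos[of v]
      by (intro mult_mono powr_mono2) auto
    moreover have "?h v \<le> 2 * k2 * v powr r * (2 * k1 * v powr \<delta>) powr q"
      using elim ks \<open>0 < q\<close> d_pos[of v] \<rho>_pos[of v]
      by (intro mult_mono powr_mono2) auto
    moreover have "k2 / 2 * v powr r * (k1 / 2 * v powr \<delta>) powr q
        = k2 / 2 * (k1 / 2) powr q * v powr s"
      using ks by (subst eq) (auto simp: s_def powr_add)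
    moreover have "2 * k2 * v powr r * (2 * k1 * v powr \<delta>) powr q
        = 2 * k2 * (2 * k1) powr q * v powr s"
      using ks by (subst eq) (auto simp: s_def powr_add)
    ultimately show ?case by (simp only:)
  qed
  have y_up: "\<forall>\<^sub>F v in at_right 0. y v \<le> M * v"
    using in01 A_le
    by (intro profile_le_linear[OF y_der _ y_lim(1)]) (auto intro: less_imp_le[OF h_pos] elim: eventually_mono)
  obtain \<eta> where \<eta>: "0 < \<eta>" "\<forall>\<^sub>F v in at_right 0. \<eta> * v powr (s / q) \<le> y v"
  proof (rule profile_ge_power[OF \<open>0 < q\<close> \<open>q \<le> s\<close> _ y_pos y_der A_le])
    show "0 < k2 / 2 * (k1 / 2) powr q" using ks by simp
    show "\<forall>\<^sub>F v in at_right 0. k2 / 2 * (k1 / 2) powr q * v powr s \<le> ?h v"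
      using h_bd by eventually_elim simp
  qed auto
  \<comment> \<open>A negative value would put \<open>y\<close> below a line of negative slope
    through 0. Consequently "nonzero" means "positive" in the case \<delta> = 1.\<close>
  have a0_nonneg: "0 \<le> cstar * g 0 - f 0"
  proof (rule ccontr)
    assume neg: "\<not> ?thesis"
    let ?B = "(cstar * g 0 - f 0) / 2"
    have "\<forall>\<^sub>F v in at_right 0. ?A v < ?B" by (rule order_tendstoD(2)[OF A_lim]) (use neg in simp)
    then have "\<forall>\<^sub>F v in at_right 0. ?A v \<le> ?B" by eventually_elim simp
    then have "\<forall>\<^sub>F v in at_right 0. y v \<le> ?B * v"
      by (intro profile_le_linear[OF y_der _ y_lim(1)]) (auto intro: less_imp_le[OF h_pos])
    then have "\<forall>\<^sub>F v in at_right (0::real). False"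
      using in01
    proof eventually_elim
      case (elim v)
      then have "?B * v < 0" using neg by (intro mult_neg_pos) auto
      with elim y_pos[of v] show ?case by simp
    qed
    then show False by simp
  qed
  \<comment> \<open>r > (1 - \<delta>) q means s > q, so the reaction along any line through 0 tends
    to 0, as the threshold argument requires.\<close>
  have lin: "\<exists>\<epsilon>>0. \<forall>\<^sub>F v in at_right 0. \<epsilon> * v \<le> y v"
    if "r > (1 - \<delta>) * q" and a0: "cstar * g 0 > f 0"
  proof -
    have "q < s" using that(1) by (simp add: s_def algebra_simps)
    have "((\<lambda>v. ?h v * v powr - q) \<longlongrightarrow> 0) (at_right 0)"
    proof (rule tendsto_sandwich[of "\<lambda>_. 0" _ _ "\<lambda>v. 2 * k2 * (2 * k1) powr q * v powr (s - q)"])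
      show "\<forall>\<^sub>F v in at_right 0. 0 \<le> ?h v * v powr - q"
        using in01
      proof eventually_elim
        case (elim v)
        show ?case using h_pos[OF elim] by simp
      qed
      show "\<forall>\<^sub>F v in at_right 0. ?h v * v powr - q \<le> 2 * k2 * (2 * k1) powr q * v powr (s - q)"
        using h_bd in01
      proof eventually_elim
        case (elim v)
        then have "?h v * v powr - q \<le> 2 * k2 * (2 * k1) powr q * v powr s * v powr - q"
          by (intro mult_right_mono) auto
        then show ?case by (simp add: mult.assoc flip: powr_add)
      qed
      have "((\<lambda>v. 2 * k2 * (2 * k1) powr q * v powr (s - q)) \<longlongrightarrow>
          2 * k2 * (2 * k1) powr q * 0 powr (s - q)) (at_right 0)"
        using \<open>q < s\<close> in01
        by (intro tendsto_mult tendsto_const tendsto_powr') (auto elim!: eventually_mono intro!: tendsto_intros)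
      then show "((\<lambda>v. 2 * k2 * (2 * k1) powr q * v powr (s - q)) \<longlongrightarrow> 0) (at_right 0)" by simp
    qed simp
    then show ?thesis
      using profile_ge_linear_at_threshold[OF \<open>p > 1\<close> q_def d_cont cont_f cont_g cont_\<rho> d_pos \<rho>_pos
          y_pos y_der y_lim(2) _ thr a0] by blast
  qed
  have T_lim: "((\<lambda>v. ereal (T v)) \<longlongrightarrow> \<beta>) (at_right 0)" using T_left by (simp add: filterlim_at)
  \<comment> \<open>The exponent \<open>e\<close> is a parameter because the criterion is used
    twice: with e = s / q from the universal lower bound and with e = 1 from minimality of the
    speed.\<close>
  have fin: "\<beta> < \<infinity>"
    if "0 < C" "\<forall>\<^sub>F v in at_right 0. C * v powr e \<le> y v" "(e - \<delta>) * q < 1" for C e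
  proof -
    have "\<forall>\<^sub>F v in at_right 0. (d v / y v) powr q \<le> (2 * k1 / C) powr q * v powr - ((e - \<delta>) * q)"
      using that(2) d_bd in01
    proof eventually_elim
      case (elim v)
      have "d v / y v \<le> 2 * k1 * v powr \<delta> / (C * v powr e)"
        using elim that(1) ks d_pos[of v] y_pos[of v] by (intro frac_le) auto
      also have "\<dots> = 2 * k1 / C * v powr (\<delta> - e)" by (simp add: powr_diff)
      finally have "(d v / y v) powr q \<le> (2 * k1 / C * v powr (\<delta> - e)) powr q"
        using elim d_pos[of v] y_pos[of v] \<open>0 < q\<close> by (intro powr_mono2) auto
      also have "\<dots> = (2 * k1 / C) powr q * v powr ((\<delta> - e) * q)"
        using that(1) ks elim by (subst powr_mult) (auto simp: powr_powr)
      finally show ?case by (simp add: algebra_simps)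
    qed
    from antiderivative_bounded_near_0[OF T_der this that(3)]
    obtain B where "\<forall>\<^sub>F v in at_right 0. T v \<le> B" by auto
    then have "\<beta> \<le> ereal B" by (intro tendsto_upperbound[OF T_lim]) auto
    then show ?thesis by (auto simp: less_top[symmetric])
  qed
  \<comment> \<open>Here the universal bound y \<le> M v suffices: the time (d / y)^q is at least of
    the nonintegrable order v^(-(1 - \<delta>) q).\<close>
  have inf: "\<beta> = \<infinity>" if "1 \<le> (1 - \<delta>) * q"
  proof -
    have "\<forall>\<^sub>F v in at_right 0. (k1 / 2 / M) powr q * v powr - ((1 - \<delta>) * q) \<le> (d v / y v) powr q"
      using y_up d_bd in01
    proof eventually_elim
      case (elim v)
      have "k1 / 2 / M * v powr (\<delta> - 1) = k1 / 2 * v powr \<delta> / (M * v)"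
        using elim by (simp add: powr_diff)
      also have "\<dots> \<le> d v / y v"
        using elim \<open>0 < M\<close> ks d_pos[of v] y_pos[of v] by (intro frac_le) auto
      finally have "(k1 / 2 / M * v powr (\<delta> - 1)) powr q \<le> (d v / y v) powr q"
        using elim \<open>0 < M\<close> ks \<open>0 < q\<close> by (intro powr_mono2) auto
      moreover have "(k1 / 2 / M * v powr (\<delta> - 1)) powr q = (k1 / 2 / M) powr q * v powr ((\<delta> - 1) * q)"
        using \<open>0 < M\<close> ks elim by (subst powr_mult) (auto simp: powr_powr)
      ultimately show ?case by (simp add: algebra_simps)
    qed
    from antiderivative_unbounded_near_0[OF T_der this that]
    have "filterlim T at_top (at_right 0)" using ks \<open>0 < M\<close> by simp
    then have "((\<lambda>v. ereal (T v)) \<longlongrightarrow> \<infinity>) (at_right 0)" by (simp add: tendsto_PInfty_eq_at_top)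
    then show ?thesis using tendsto_unique[OF _ T_lim] by simp
  qed
  have u'_lim: "filterlim (deriv u \<circ> real_of_ereal) F (at_left \<beta>)"
    if "filterlim (\<lambda>v. - ((y v / d v) powr q)) F (at_right 0)" for F
    using filterlim_compose[OF that u_left] u_deriv by (simp add: filterlim_cong)
  have u'_0: "((deriv u \<circ> real_of_ereal) \<longlongrightarrow> 0) (at_left \<beta>)"
    if "((\<lambda>v. y v / d v) \<longlongrightarrow> 0) (at_right 0)"
  proof (rule u'_lim)
    have "((\<lambda>v. - ((y v / d v) powr q)) \<longlongrightarrow> - (0 powr q)) (at_right 0)"
      using that \<open>0 < q\<close> in01 d_pos y_pos
      by (intro tendsto_minus tendsto_powr') (auto elim!: eventually_mono simp: less_imp_le)
    then show "((\<lambda>v. - ((y v / d v) powr q)) \<longlongrightarrow> 0) (at_right 0)" by simp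
  qed
  have yd_up: "\<forall>\<^sub>F v in at_right 0. y v / d v \<le> 2 * B / k1 * v powr (1 - \<delta>)"
    if "\<forall>\<^sub>F v in at_right 0. y v \<le> B * v" "0 < B" for B
    using that(1) d_bd in01
  proof eventually_elim
    case (elim v)
    have "y v / d v \<le> B * v / (k1 / 2 * v powr \<delta>)"
      using elim that(2) ks d_pos[of v] y_pos[of v] by (intro frac_le) auto
    also have "\<dots> = 2 * B / k1 * v powr (1 - \<delta>)" using elim by (simp add: powr_diff)
    finally show ?case .
  qed
  have yd_nonneg: "\<forall>\<^sub>F v in at_right 0. 0 \<le> y v / d v"
    using in01
  proof eventually_elim
    case (elim v)
    show ?case using d_pos[OF elim] y_pos[OF elim] by simp
  qed
  have yd_low: "\<forall>\<^sub>F v in at_right 0. \<epsilon> / (2 * k1) * v powr (1 - \<delta>) \<le> y v / d v"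
    if "\<forall>\<^sub>F v in at_right 0. \<epsilon> * v \<le> y v" "0 < \<epsilon>" for \<epsilon>
    using that(1) d_bd in01
  proof eventually_elim
    case (elim v)
    have "\<epsilon> / (2 * k1) * v powr (1 - \<delta>) = \<epsilon> * v / (2 * k1 * v powr \<delta>)"
      using elim by (simp add: powr_diff)
    also have "\<dots> \<le> y v / d v"
      using elim that(2) ks d_pos[of v] y_pos[of v] by (intro frac_le) auto
    finally show ?case .
  qed
  have sub_1: "((deriv u \<circ> real_of_ereal) \<longlongrightarrow> 0) (at_left \<beta>)" if "\<delta> < 1"
  proof (rule u'_0, rule tendsto_sandwich[OF yd_nonneg yd_up[OF y_up \<open>0 < M\<close>] tendsto_const])
    have "((\<lambda>v. 2 * M / k1 * v powr (1 - \<delta>)) \<longlongrightarrow> 2 * M / k1 * 0 powr (1 - \<delta>)) (at_right 0)"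
      using \<open>\<delta> < 1\<close> in01
      by (intro tendsto_mult tendsto_const tendsto_powr') (auto elim!: eventually_mono intro!: tendsto_intros)
    then show "((\<lambda>v. 2 * M / k1 * v powr (1 - \<delta>)) \<longlongrightarrow> 0) (at_right 0)" by simp
  qed
  have eq_1_zero: "((deriv u \<circ> real_of_ereal) \<longlongrightarrow> 0) (at_left \<beta>)"
    if "\<delta> = 1" "cstar * g 0 - f 0 = 0"
  proof (rule u'_0, rule tendstoI)
    fix e :: real assume "0 < e"
    \<comment> \<open>With \<delta> = 1 the bound y \<le> B v gives y / d \<le> 2 B / k1, which is e
      / 2 for this choice.\<close>
    define B where "B = e * k1 / 4"
    have "0 < B" using \<open>0 < e\<close> ks by (simp add: B_def)
    have "\<forall>\<^sub>F v in at_right 0. ?A v < B"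
      by (rule order_tendstoD(2)[OF A_lim]) (use that \<open>0 < B\<close> in simp)
    then have "\<forall>\<^sub>F v in at_right 0. ?A v \<le> B" by eventually_elim simp
    then have "\<forall>\<^sub>F v in at_right 0. y v \<le> B * v"
      by (intro profile_le_linear[OF y_der _ y_lim(1)]) (auto intro: less_imp_le[OF h_pos])
    from yd_up[OF this \<open>0 < B\<close>] yd_nonneg in01
    show "\<forall>\<^sub>F v in at_right 0. dist (y v / d v) 0 < e"
    proof eventually_elim
      case (elim v)
      then have "y v / d v \<le> e / 2" using that ks by (simp add: B_def)
      with elim \<open>0 < e\<close> show ?case unfolding dist_real_def by linarith
    qed
  qed
  have eq_1_pos: "\<not> ((deriv u \<circ> real_of_ereal) \<longlongrightarrow> 0) (at_left \<beta>)"
    if "\<delta> = 1" "cstar * g 0 - f 0 \<noteq> 0"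
  proof
    assume lim: "((deriv u \<circ> real_of_ereal) \<longlongrightarrow> 0) (at_left \<beta>)"
    have "(1 - \<delta>) * q < r" "f 0 < cstar * g 0" using that a0_nonneg ks by auto
    then obtain \<epsilon> where \<epsilon>: "0 < \<epsilon>" "\<forall>\<^sub>F v in at_right 0. \<epsilon> * v \<le> y v"
      using lin by blast
    let ?c = "(\<epsilon> / (2 * k1)) powr q"
    have "\<forall>\<^sub>F v in at_right 0. ?c \<le> (y v / d v) powr q"
      using yd_low[OF \<epsilon>(2,1)] in01
    proof eventually_elim
      case (elim v)
      then have "\<epsilon> / (2 * k1) \<le> y v / d v" using that by simp
      then show ?case using \<epsilon> ks \<open>0 < q\<close> by (intro powr_mono2) auto
    qed
    from filterlim_iff[THEN iffD1, OF u_left, rule_format, OF this] u_deriv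
    have "\<forall>\<^sub>F x in at_left \<beta>. (deriv u \<circ> real_of_ereal) x \<le> - ?c" by eventually_elim simp
    \<comment> \<open>A limit along a trivial filter would carry no information; \<open>T\<close>
      maps a nontrivial filter into this one.\<close>
    moreover have "at_left \<beta> \<noteq> bot"
    proof
      assume "at_left \<beta> = bot"
      then have "\<forall>\<^sub>F x in at_left \<beta>. False" by simp
      from filterlim_iff[THEN iffD1, OF T_left, rule_format, OF this] show False by simp
    qed
    ultimately have "0 \<le> - ?c" by (intro tendsto_upperbound[OF lim])
    moreover have "0 < ?c" using \<epsilon> ks by simp
    ultimately show False by simp
  qed
  have gt_1: "filterlim (deriv u \<circ> real_of_ereal) at_bot (at_left \<beta>)"
    if "\<delta> > 1" and a0: "cstar * g 0 > f 0"
  proof (rule u'_lim)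
    \<comment> \<open>For \<delta> > 1 the strict inequality on \<open>r\<close> is automatic, so
      the linear lower bound is available and y / d is at least of order v^(1 - \<delta>), which
      blows up.\<close>
    have "(1 - \<delta>) * q < 0" using that(1) \<open>0 < q\<close> by (intro mult_neg_pos) auto
    then have "(1 - \<delta>) * q < r" using ks by linarith
    then obtain \<epsilon> where \<epsilon>: "0 < \<epsilon>" "\<forall>\<^sub>F v in at_right 0. \<epsilon> * v \<le> y v"
      using lin a0 by blast
    let ?c = "(\<epsilon> / (2 * k1)) powr q"
    have c: "0 < ?c" using \<epsilon> ks by simp
    have "\<forall>\<^sub>F v in at_right 0. ?c * v powr ((1 - \<delta>) * q) \<le> (y v / d v) powr q"
      using yd_low[OF \<epsilon>(2,1)] in01
    proof eventually_elim
      case (elim v)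
      then have "(\<epsilon> / (2 * k1) * v powr (1 - \<delta>)) powr q \<le> (y v / d v) powr q"
        using \<epsilon> ks \<open>0 < q\<close> by (intro powr_mono2) auto
      moreover have "(\<epsilon> / (2 * k1) * v powr (1 - \<delta>)) powr q = ?c * v powr ((1 - \<delta>) * q)"
        using \<epsilon> ks elim by (subst powr_mult) (auto simp: powr_powr)
      ultimately show ?case by (simp only:)
    qed
    moreover have "filterlim (\<lambda>v. ?c * v powr ((1 - \<delta>) * q)) at_top (at_right 0)"
    proof (rule filterlim_tendsto_pos_mult_at_top[OF tendsto_const c])
      have "filterlim (\<lambda>v. v powr ((1 - \<delta>) * q)) at_top (at_right 0)"
        using \<open>(1 - \<delta>) * q < 0\<close> by real_asymp
      then show "filterlim (\<lambda>v. v powr ((1 - \<delta>) * q)) at_top (at_right 0)" .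
    qed
    ultimately have "filterlim (\<lambda>v. (y v / d v) powr q) at_top (at_right 0)"
      by (rule filterlim_at_top_mono[rotated])
    then show "filterlim (\<lambda>v. - ((y v / d v) powr q)) at_bot (at_right 0)"
      by (simp add: filterlim_uminus_at_top)
  qed
  have r_lt_1: "\<beta> < \<infinity>" if "r < 1"
  proof (rule fin[OF \<eta>])
    \<comment> \<open>With the universal lower bound the contribution of \<open>\<delta>\<close>
      cancels, which is why the first criterion involves \<open>r\<close> alone.\<close>
    have "(s / q - \<delta>) * q = r" using \<open>0 < q\<close> by (simp add: s_def left_diff_distrib)
    then show "(s / q - \<delta>) * q < 1" using that by simp
  qed
  have generic: "\<beta> < \<infinity> \<longleftrightarrow> (1 - \<delta>) * q < 1" if gt: "r > (1 - \<delta>) * q" and a0: "cstar * g 0 > f 0"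
  proof
    show "\<beta> < \<infinity> \<Longrightarrow> (1 - \<delta>) * q < 1" using inf by (cases "1 \<le> (1 - \<delta>) * q") auto
  next
    obtain \<epsilon> where \<epsilon>: "0 < \<epsilon>" "\<forall>\<^sub>F v in at_right 0. \<epsilon> * v \<le> y v"
      using lin[OF gt a0] by auto
    have "\<forall>\<^sub>F v in at_right 0. \<epsilon> * v powr 1 \<le> y v"
      using \<epsilon>(2) in01 by eventually_elim simp
    from fin[OF \<epsilon>(1) this] show "(1 - \<delta>) * q < 1 \<Longrightarrow> \<beta> < \<infinity>" .
  qed
  have critical: "r = (1 - \<delta>) * q \<and> r \<ge> 1 \<longrightarrow> \<beta> = \<infinity>" using inf by simp
  show ?thesis
    unfolding div_q using r_lt_1 critical generic sub_1 eq_1_zero eq_1_pos gt_1 by blast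
qed

end
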